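(* Let $\rightsquigarrow$ be a 1-eternal relation, $G$ a finite group, $p$ a prime divisor of $|G|$, and $S$ a Sylow $p$-subgroup of $G$. Suppose that there exists a subgroup $D$ with $1<D<S$ such that every subgroup of $S$ of order $|D|$ or $p|D|$ is abelian, every subgroup $H$ of $S$ of order $|D|$ satisfies $H\rightsquigarrow G$, and, if $S$ is a non-abelian $2$-group and $|D|=2$, every cyclic subgroup $H$ of $S$ of order $4$ satisfies $H\rightsquigarrow G$. Then $\mathcal{F}_S(G)$ is supersolvable.
   Context: All groups are finite. $Z_{\mathfrak{U}}(G)$ denotes the supersolvable hypercenter of $G$: the largest normal subgroup $N$ of $G$ such that every chief factor of $G$ below $N$ is cyclic (of prime order). Let $\rightsquigarrow$ be a relation, defined for every finite group $G$, between subgroups $H\le G$ and $G$ (written $H\rightsquigarrow G$). It is called 1-eternal if for every finite group $G$ the following hold: (0) for all subgroups $H\le K\le G$, if $H\rightsquigarrow G$ then $H\rightsquigarrow K$; (1) for every prime divisor $p$ of $|G|$: if there exists a subgroup $D$ of $O_p(G)$ with $1<|D|<|O_p(G)|$ such that every subgroup $H$ of $O_p(G)$ of order $|D|$ satisfies $H\rightsquigarrow G$ and, in case $O_p(G)$ is non-abelian and $|D|=2$, every cyclic subgroup $H$ of $O_p(G)$ of order $4$ satisfies $H\rightsquigarrow G$, then $O_p(G)\le Z_{\mathfrak{U}}(G)$. $\mathcal{F}_S(G)$ is the (saturated) fusion system on $S\in\mathrm{Syl}_p(G)$ whose objects are the subgroups of $S$ and whose morphisms $P\to Q$ are the maps $x\mapsto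 x^g$ with $g\in G$, $P^g\le Q$. A saturated fusion system $\mathcal{F}$ on a $p$-group $S$ is supersolvable if there is a series $1=S_0\le S_1\le\cdots\le S_n=S$ of strongly $\mathcal{F}$-closed subgroups of $S$ with $S_{i+1}/S_i$ cyclic for $0\le i\le n-1$. (A subgroup $T\le S$ is strongly $\mathcal{F}$-closed if for every $P\le T$ and every $\phi\in\mathrm{Hom}_{\mathcal{F}}(P,S)$ one has $P^{\phi}\le T$.) *)

theory Defs
  imports "HOL-Algebra.Elementary_Groups" "HOL-Computational_Algebra.Primes"
begin

abbreviation subgrp :: "('a, 'b) monoid_scheme \<Rightarrow> 'a set \<Rightarrow> ('a, 'b) monoid_scheme" where
  "subgrp G H \<equiv> G\<lparr>carrier := H\<rparr>"

definition p_group :: "nat \<Rightarrow> ('a, 'b) monoid_scheme \<Rightarrow> bool" where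
  "p_group p G \<longleftrightarrow> group G \<and> (\<exists>k. order G = p ^ k)"

definition sylow_subgroup :: "nat \<Rightarrow> ('a, 'b) monoid_scheme \<Rightarrow> 'a set \<Rightarrow> bool" where
  "sylow_subgroup p G S \<longleftrightarrow> subgroup S G \<and> card S = p ^ multiplicity p (order G)"

(* O_p(G), the largest normal p-subgroup.  Here and below, GREATEST refers to inclusion;
   the greatest element exists for finite G because the product of two normal p-subgroups
   is again one. *)
definition p_core :: "nat \<Rightarrow> ('a, 'b) monoid_scheme \<Rightarrow> 'a set" where
  "p_core p G = (GREATEST N. N \<lhd> G \<and> p_group p (subgrp G N))"

definition chief_factor :: "('a, 'b) monoid_scheme \<Rightarrow> 'a set \<Rightarrow> 'a set \<Rightarrow> bool" where
  "chief_factor G H K \<longleftrightarrow> H \<lhd> G \<and> K \<lhd> G \<and> K \<subset> H \<and>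
     \<not> (\<exists>L. L \<lhd> G \<and> K \<subset> L \<and> L \<subset> H)"

(* A cyclic chief factor automatically has prime order. *)
definition supersolvable_hypercenter :: "('a, 'b) monoid_scheme \<Rightarrow> 'a set" where
  "supersolvable_hypercenter G =
     (GREATEST N. N \<lhd> G \<and>
        (\<forall>H K. chief_factor G H K \<and> H \<subseteq> N \<longrightarrow> cyclic_group (subgrp G H Mod K)))"

(* R H G stands for the relation "H ~> G".  All groups have their elements in the type 'a,
   which is arbitrary.  Nothing is lost by this: a relation that is 1-eternal on the finite
   groups over 'a extends by False to a 1-eternal relation on all finite groups. *)
definition one_eternal :: "('a set \<Rightarrow> 'a monoid \<Rightarrow> bool) \<Rightarrow> bool" where
  "one_eternal R \<longleftrightarrow>
     (\<forall>G. group G \<and> finite (carrier G) \<longrightarrow>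
        (\<forall>H K. subgroup H G \<and> subgroup K G \<and> H \<subseteq> K \<and> R H G \<longrightarrow> R H (subgrp G K)) \<and>
        (\<forall>p. prime p \<and> p dvd order G \<longrightarrow>
           (\<exists>D. subgroup D G \<and> D \<subseteq> p_core p G \<and> 1 < card D \<and> card D < card (p_core p G) \<and>
              (\<forall>H. subgroup H G \<and> H \<subseteq> p_core p G \<and> card H = card D \<longrightarrow> R H G) \<and>
              (\<not> comm_group (subgrp G (p_core p G)) \<and> card D = 2 \<longrightarrow>
                 (\<forall>H. subgroup H G \<and> H \<subseteq> p_core p G \<and> cyclic_group (subgrp G H) \<and> card H = 4
                    \<longrightarrow> R H G))) \<longrightarrow>
           p_core p G \<subseteq> supersolvable_hypercenter G))"

(* A fusion system on S is represented by its morphism sets: F P Q is the set of morphisms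
   P \<rightarrow> Q between subgroups P, Q of S, where a map with domain P is an element of the
   function type that is undefined outside P. *)
type_synonym 'a fusion_homs = "'a set \<Rightarrow> 'a set \<Rightarrow> ('a \<Rightarrow> 'a) set"

definition fusion_system :: "('a, 'b) monoid_scheme \<Rightarrow> 'a set \<Rightarrow> 'a fusion_homs" where
  "fusion_system G S P Q =
     {\<phi>. subgroup P (subgrp G S) \<and> subgroup Q (subgrp G S) \<and>
         (\<exists>g\<in>carrier G. \<phi> = (\<lambda>x\<in>P. inv\<^bsub>G\<^esub> g \<otimes>\<^bsub>G\<^esub> x \<otimes>\<^bsub>G\<^esub> g) \<and> \<phi> ` P \<subseteq> Q)}"

(* In the following two definitions F is a fusion system on the group S. *)
definition strongly_closed :: "('a, 'b) monoid_scheme \<Rightarrow> 'a fusion_homs \<Rightarrow> 'a set \<Rightarrow> bool" where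
  "strongly_closed S F T \<longleftrightarrow> subgroup T S \<and>
     (\<forall>P. subgroup P S \<and> P \<subseteq> T \<longrightarrow> (\<forall>\<phi> \<in> F P (carrier S). \<phi> ` P \<subseteq> T))"

(* Strongly closed subgroups are normal in S, so the quotients are groups.  Saturation of F
   is a standing assumption, not a part of the definition; it always holds for the fusion
   system of a finite group on a Sylow subgroup. *)
definition supersolvable_fusion :: "('a, 'b) monoid_scheme \<Rightarrow> 'a fusion_homs \<Rightarrow> bool" where
  "supersolvable_fusion S F \<longleftrightarrow>
     (\<exists>(n::nat) A. A 0 = {\<one>\<^bsub>S\<^esub>} \<and> A n = carrier S \<and>
        (\<forall>i\<le>n. strongly_closed S F (A i)) \<and>
        (\<forall>i<n. A i \<subseteq> A (Suc i) \<and> cyclic_group (subgrp S (A (Suc i)) Mod A i)))"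

end

theory Submission
  imports Defs "HOL-Algebra.Sylow" "HOL-Algebra.Group_Action" "HOL-Algebra.SndIsomorphismGrp"
    "HOL-Number_Theory.Residues"
begin

text \<open>
  Put \<open>N = N\<^sub>G(Q)\<close> for \<open>Q \<le> S\<close>. As in Alperin's fusion theorem, it suffices to show, for every proper
  subgroup \<open>Q\<close> of \<open>S\<close> such that \<open>T = N\<^sub>S(Q)\<close> is Sylow in \<open>N\<close>, that the action of each element of \<open>N\<close>
  on \<open>Q\<close> is induced by an element normalising a larger subgroup of \<open>S\<close>; then \<open>N\<^sub>G(S)\<close> controls
  fusion in \<open>S\<close>. If \<open>C\<^sub>S(Q)\<close> is not contained in \<open>Q\<close>, a Frattini argument in \<open>C\<^sub>G(Q)\<close> gives the larger
  subgroup \<open>Q C\<^sub>S(Q)\<close>. Otherwise \<open>|Q| > |D|\<close>, because all subgroups of order \<open>|D|\<close> and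
  \<open>p|D|\<close> are abelian. If \<open>O\<^sub>p(N) > Q\<close>, this core is the larger subgroup. If \<open>O\<^sub>p(N) = Q\<close>,
  then 1-eternality puts \<open>Q\<close> into the supersolvable hypercenter of \<open>N\<close>. The elements of \<open>N\<close> that
  act trivially on all chief factors below \<open>Q\<close> then form the normal subgroup \<open>C\<^sub>G(Q) T\<close>, and
  the Frattini argument gives the larger subgroup \<open>T\<close>. Finally, 1-eternality for \<open>N\<^sub>G(S)\<close> gives a
  series of \<open>N\<^sub>G(S)\<close>-invariant subgroups of \<open>S\<close> with cyclic factors; they are strongly closed.
\<close>

section \<open>Sylow subgroups and fixed points of \<open>p\<close>-groups\<close>

text \<open>Orbit sizes divide \<open>p ^ k\<close>, so an orbit is a single fixed point or has size
  divisible by p; hence |E| and the number of fixed points agree modulo p. Both directions matter: a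
  set of size prime to p has a fixed point, and in a set of size divisible by p one fixed point
  implies a second.\<close>

lemma (in group_action) p_group_fixed_points:
  assumes p: "prime p" and ord: "order G = p ^ k" and fin: "finite E"
  shows "p dvd card E \<longleftrightarrow> p dvd card {x \<in> E. \<forall>g\<in>carrier G. \<phi> g x = x}"
proof -
  let ?O = "orbits G E \<phi>"
  let ?F = "{x \<in> E. \<forall>g\<in>carrier G. \<phi> g x = x}"
  interpret G: group G using group_hom group_hom.axioms(1) by auto
  have finO: "finite ?O" unfolding orbits_def using fin by auto
  have un: "\<Union> ?O = E" by (rule orbits_coverture)
  have orbE: "orb \<subseteq> E" if "orb \<in> ?O" for orb using un that by blast
  have fixed: "orbit G \<phi> x = {x}" if "x \<in> ?F" for x
    unfolding orbit_def using that G.one_closed by force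
  have img: "(\<lambda>x. {x}) ` ?F = {orb \<in> ?O. card orb = 1}"
  proof (intro equalityI subsetI)
    fix orb assume "orb \<in> (\<lambda>x. {x}) ` ?F"
    then obtain x where x: "x \<in> ?F" "orb = {x}" by auto
    then show "orb \<in> {orb \<in> ?O. card orb = 1}" using fixed[of x] by (auto simp: orbits_def)
  next
    fix orb assume "orb \<in> {orb \<in> ?O. card orb = 1}"
    then obtain x where x: "x \<in> E" "orb = orbit G \<phi> x" "card orb = 1" by (auto simp: orbits_def)
    then have "orb = {x}" using orbit_refl by (metis card_1_singletonE singletonD)
    then have "\<phi> g x = x" if "g \<in> carrier G" for g
      using x(2) that unfolding orbit_def by blast
    then show "orb \<in> (\<lambda>x. {x}) ` ?F" using x(1) \<open>orb = {x}\<close> by auto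
  qed
  have cF: "card ?F = card {orb \<in> ?O. card orb = 1}"
    unfolding img[symmetric] by (rule card_image[symmetric]) auto
  have "card E = (\<Sum>orb\<in>?O. card orb)"
    using disjoint_sum[OF fin, of "\<lambda>_. 1::nat"] by simp
  also have "\<dots> = (\<Sum>orb\<in>{orb \<in> ?O. card orb = 1}. card orb) + (\<Sum>orb\<in>{orb \<in> ?O. card orb \<noteq> 1}. card orb)"
    using finO by (subst sum.union_disjoint[symmetric]) (auto intro: arg_cong2[where f=sum])
  also have "(\<Sum>orb\<in>{orb \<in> ?O. card orb = 1}. card orb) = card ?F"
    unfolding cF by simp
  finally have e: "card E = card ?F + (\<Sum>orb\<in>{orb \<in> ?O. card orb \<noteq> 1}. card orb)" .
  have "p dvd card orb" if "orb \<in> ?O" "card orb \<noteq> 1" for orb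
  proof -
    from that obtain x where "x \<in> E" "orb = orbit G \<phi> x" by (auto simp: orbits_def)
    then have "card orb dvd p ^ k" using orbit_stabilizer_theorem ord by (metis dvd_triv_left)
    then obtain i where "card orb = p ^ i" using p divides_primepow_nat by blast
    then show ?thesis using that(2) by (cases i) auto
  qed
  then have "p dvd (\<Sum>orb\<in>{orb \<in> ?O. card orb \<noteq> 1}. card orb)" by (auto intro: dvd_sum)
  then show ?thesis unfolding e using dvd_add_left_iff by blast
qed

context group
begin

section \<open>Lagrange's theorem, conjugation, normalisers and centralisers\<close>

lemma subgroup_card_dvd:
  assumes "subgroup H G" "subgroup K G" "H \<subseteq> K"
  shows "card H dvd card K"
proof -
  have "card (rcosets\<^bsub>subgrp G K\<^esub> H) * card H = card K"
    using group.lagrange[OF subgroup_imp_group[OF assms(2)] subgroup_incl[OF assms]]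
    by (simp add: order_def)
  then show ?thesis by (metis dvd_triv_right)
qed

text \<open>The right action \<open>x^g\<close> from \<open>fusion_system\<close>: conjugating first
  by g and then by h is conjugating by \<open>g \<otimes> h\<close>.\<close>

definition conjby :: "'a \<Rightarrow> 'a \<Rightarrow> 'a" where "conjby g x = inv g \<otimes> x \<otimes> g"

lemma conjby_closed [simp, intro]: "g \<in> carrier G \<Longrightarrow> x \<in> carrier G \<Longrightarrow> conjby g x \<in> carrier G"
  by (simp add: conjby_def)

lemma conjby_conjby [simp]:
  assumes "g \<in> carrier G" "h \<in> carrier G" "x \<in> carrier G"
  shows "conjby h (conjby g x) = conjby (g \<otimes> h) x"
  using assms by (simp add: conjby_def inv_mult_group m_assoc)

lemma conjby_one [simp]: "x \<in> carrier G \<Longrightarrow> conjby \<one> x = x"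
  by (simp add: conjby_def)

lemma conjby_of_one [simp]: "g \<in> carrier G \<Longrightarrow> conjby g \<one> = \<one>"
  by (simp add: conjby_def)

lemma conjby_mult:
  assumes "g \<in> carrier G" "x \<in> carrier G" "y \<in> carrier G"
  shows "conjby g (x \<otimes> y) = conjby g x \<otimes> conjby g y"
  using assms by (simp add: conjby_def m_assoc) (simp add: m_assoc[symmetric])

lemma conjby_m_inv:
  assumes "g \<in> carrier G" "x \<in> carrier G"
  shows "conjby g (inv x) = inv (conjby g x)"
  using assms by (simp add: conjby_def inv_mult_group m_assoc)

lemma conjby_pow:
  assumes "g \<in> carrier G" "x \<in> carrier G"
  shows "conjby g (x [^] (n::nat)) = conjby g x [^] n"
  using assms by (induction n) (auto simp: conjby_mult)

lemma conjby_inj: "g \<in> carrier G \<Longrightarrow> A \<subseteq> carrier G \<Longrightarrow> inj_on (conjby g) A"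
  by (rule inj_on_inverseI[where g="conjby (inv g)"]) auto

lemma card_conjby: "g \<in> carrier G \<Longrightarrow> A \<subseteq> carrier G \<Longrightarrow> card (conjby g ` A) = card A"
  by (rule card_image[OF conjby_inj])

lemma conjby_hom: "g \<in> carrier G \<Longrightarrow> conjby g \<in> hom G G"
  by (auto simp: hom_def conjby_mult)

lemma conjby_subgroup: "g \<in> carrier G \<Longrightarrow> subgroup H G \<Longrightarrow> subgroup (conjby g ` H) G"
  using group_hom.subgroup_img_is_subgroup[of G G "conjby g" H] conjby_hom
  by (simp add: group_hom_def group_hom_axioms_def)

lemma conjby_image_conjby:
  assumes "g \<in> carrier G" "h \<in> carrier G" "A \<subseteq> carrier G"
  shows "conjby h ` conjby g ` A = conjby (g \<otimes> h) ` A"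
  unfolding image_image using assms by (intro image_cong) auto

lemma conjby_image_one: "A \<subseteq> carrier G \<Longrightarrow> conjby \<one> ` A = A"
  by force

text \<open>The normaliser \<open>N_G(H)\<close>, with equality of the image instead of inclusion so
  that inverses stay inside without any finiteness assumption.\<close>

definition Nrm :: "'a set \<Rightarrow> 'a set" where
  "Nrm H = {g \<in> carrier G. conjby g ` H = H}"

definition Cen :: "'a set \<Rightarrow> 'a set" where
  "Cen H = {g \<in> carrier G. \<forall>x\<in>H. conjby g x = x}"

lemma Nrm_subgroup:
  assumes H: "H \<subseteq> carrier G"
  shows "subgroup (Nrm H) G"
proof (rule subgroupI)
  show "Nrm H \<noteq> {}" using conjby_image_one[OF H] by (auto simp: Nrm_def)
  fix a assume a: "a \<in> Nrm H"
  then have "conjby (inv a) ` H = conjby (inv a) ` conjby a ` H" by (simp add: Nrm_def)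
  also have "\<dots> = H" using a H by (subst conjby_image_conjby) (auto simp: Nrm_def conjby_image_one)
  finally show "inv a \<in> Nrm H" using a by (simp add: Nrm_def)
next
  fix a b assume "a \<in> Nrm H" "b \<in> Nrm H"
  then show "a \<otimes> b \<in> Nrm H" using H by (simp add: Nrm_def conjby_image_conjby[symmetric])
qed (auto simp: Nrm_def)

lemma Cen_subgroup:
  assumes H: "H \<subseteq> carrier G"
  shows "subgroup (Cen H) G"
proof (rule subgroupI)
  show "Cen H \<noteq> {}" using H by (auto simp: Cen_def intro!: exI[of _ \<one>])
  fix a assume a: "a \<in> Cen H"
  have "conjby (inv a) x = x" if "x \<in> H" for x
  proof -
    have "conjby (inv a) x = conjby (inv a) (conjby a x)" using a that by (simp add: Cen_def)
    also have "\<dots> = x" using a that H by (subst conjby_conjby) (auto simp: Cen_def)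
    finally show ?thesis .
  qed
  then show "inv a \<in> Cen H" using a by (simp add: Cen_def)
next
  fix a b assume ab: "a \<in> Cen H" "b \<in> Cen H"
  have "conjby (a \<otimes> b) x = x" if "x \<in> H" for x
  proof -
    have "conjby (a \<otimes> b) x = conjby b (conjby a x)"
      using ab that H by (subst conjby_conjby) (auto simp: Cen_def)
    then show ?thesis using ab that by (simp add: Cen_def)
  qed
  then show "a \<otimes> b \<in> Cen H" using ab by (simp add: Cen_def)
qed (auto simp: Cen_def)

text \<open>Conjugation is injective, so a finite set that is mapped into itself is mapped onto
  itself.\<close>

lemma NrmI:
  assumes "finite H" "H \<subseteq> carrier G" "g \<in> carrier G" "conjby g ` H \<subseteq> H"
  shows "g \<in> Nrm H"
  using assms card_conjby[of g H] by (simp add: Nrm_def card_subset_eq)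

lemma Nrm_self: "finite H \<Longrightarrow> subgroup H G \<Longrightarrow> H \<subseteq> Nrm H"
  by (auto intro!: NrmI simp: subgroup.subset subgroup.mem_carrier conjby_def
      subgroup.m_closed subgroup.m_inv_closed)

lemma Nrm_in: "g \<in> Nrm H \<Longrightarrow> x \<in> H \<Longrightarrow> conjby g x \<in> H"
  unfolding Nrm_def by blast

lemma Cen_le_Nrm: "Cen H \<subseteq> Nrm H"
  unfolding Nrm_def Cen_def by force

section \<open>Subgroups acting on right cosets, and the fixed cosets\<close>

lemma coset_group_action:
  assumes P: "subgroup P G" and T: "subgroup T G"
  shows "group_action (subgrp G P) (rcosets T) (\<lambda>g. \<lambda>X\<in>rcosets T. X #> inv g)"
proof -
  let ?E = "rcosets T"
  \<comment> \<open>A \<open>group_action\<close> is a left action by extensional bijections, while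
    cosets are multiplied from the right; hence the inverse of g and the restriction to the set of
    cosets.\<close>
  let ?f = "\<lambda>g. \<lambda>X\<in>?E. X #> inv g"
  have Tc: "T \<subseteq> carrier G" using T by (rule subgroup.subset)
  have Pc: "g \<in> carrier G" if "g \<in> P" for g using P that by (rule subgroup.mem_carrier)
  have E: "X #> g \<in> ?E" if "X \<in> ?E" "g \<in> carrier G" for X g
    using that Tc by (auto simp: RCOSETS_def coset_mult_assoc)
  have Xc: "X \<subseteq> carrier G" if "X \<in> ?E" for X
    using that rcosets_part_G[OF T] by blast
  have bij: "?f g \<in> Bij ?E" if g: "g \<in> carrier G" for g
  proof -
    have "bij_betw (\<lambda>X. X #> inv g) ?E ?E"
      by (rule bij_betw_byWitness[where f'="\<lambda>X. X #> g"])
        (use g in \<open>auto simp: E coset_mult_assoc Xc\<close>)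
    then show ?thesis by (auto simp: Bij_def cong: bij_betw_cong)
  qed
  have "?f \<in> hom (subgrp G P) (BijGroup ?E)"
  proof (rule homI)
    fix x assume "x \<in> carrier (subgrp G P)"
    then show "?f x \<in> carrier (BijGroup ?E)" using bij Pc by (simp add: BijGroup_def)
  next
    fix x y assume "x \<in> carrier (subgrp G P)" "y \<in> carrier (subgrp G P)"
    then have x: "x \<in> carrier G" and y: "y \<in> carrier G" using Pc by auto
    have "?f (x \<otimes> y) = compose ?E (?f x) (?f y)"
      using x y by (auto simp: compose_def fun_eq_iff E coset_mult_assoc Xc inv_mult_group)
    then show "?f (x \<otimes>\<^bsub>subgrp G P\<^esub> y) = ?f x \<otimes>\<^bsub>BijGroup ?E\<^esub> ?f y"
      using bij x y by (simp add: BijGroup_def)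
  qed
  then show ?thesis
    using subgroup_imp_group[OF P] group_BijGroup
    by (simp add: group_action_def group_hom_def group_hom_axioms_def)
qed

text \<open>The stabiliser of the coset T g is the conjugate
  \<open>inv g \<otimes> T \<otimes> g\<close>, so P fixes the coset exactly if \<open>inv g\<close>
  conjugates P into T.\<close>

lemma coset_fixed_iff:
  assumes T: "subgroup T G" and P: "subgroup P G" and g: "g \<in> carrier G"
  shows "(\<forall>u\<in>P. (T #> g) #> inv u = T #> g) \<longleftrightarrow> conjby (inv g) ` P \<subseteq> T"
proof -
  have Tc: "T \<subseteq> carrier G" using T by (rule subgroup.subset)
  have "(T #> g) #> inv u = T #> g \<longleftrightarrow> conjby (inv g) u \<in> T" if u: "u \<in> P" for u
  proof -
    have uc: "u \<in> carrier G" using P u by (rule subgroup.mem_carrier)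
    have "(T #> g) #> inv u = T #> g \<longleftrightarrow> T #> (g \<otimes> inv u) = T #> g"
      using uc g Tc by (simp add: coset_mult_assoc)
    also have "\<dots> \<longleftrightarrow> T #> (g \<otimes> inv (g \<otimes> inv u)) = T"
    proof
      assume "T #> (g \<otimes> inv u) = T #> g"
      then show "T #> (g \<otimes> inv (g \<otimes> inv u)) = T"
        using uc g Tc coset_mult_inv2[of T g "g \<otimes> inv u"] by simp
    next
      assume "T #> (g \<otimes> inv (g \<otimes> inv u)) = T"
      then show "T #> (g \<otimes> inv u) = T #> g"
        using uc g Tc coset_mult_inv1[of T g "g \<otimes> inv u"] by simp
    qed
    also have "g \<otimes> inv (g \<otimes> inv u) = conjby (inv g) u"
      using uc g by (simp add: conjby_def inv_mult_group m_assoc)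
    also have "T #> conjby (inv g) u = T \<longleftrightarrow> conjby (inv g) u \<in> T"
      using coset_join1[OF _ _ T] coset_join2[OF _ T] uc g by auto
    finally show ?thesis .
  qed
  then show ?thesis by auto
qed

lemma coset_fixed_points_dvd:
  assumes fin: "finite (carrier G)" and p: "prime p"
    and P: "subgroup P G" "card P = p ^ k" and T: "subgroup T G"
  shows "p dvd card (rcosets T) \<longleftrightarrow> p dvd card {X \<in> rcosets T. \<forall>u\<in>P. X #> inv u = X}"
proof -
  interpret A: group_action "subgrp G P" "rcosets T" "\<lambda>g. \<lambda>X\<in>rcosets T. X #> inv g"
    by (rule coset_group_action[OF P(1) T])
  have "finite (rcosets T)" using fin unfolding RCOSETS_def by auto
  then have "p dvd card (rcosets T) \<longleftrightarrow> p dvd card {X \<in> rcosets T. \<forall>g\<in>carrier (subgrp G P). (\<lambda>X\<in>rcosets T. X #> inv g) X = X}"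
    using A.p_group_fixed_points[OF p, of k] P(2) by (simp add: order_def)
  also have "{X \<in> rcosets T. \<forall>g\<in>carrier (subgrp G P). (\<lambda>X\<in>rcosets T. X #> inv g) X = X} = {X \<in> rcosets T. \<forall>u\<in>P. X #> inv u = X}"
    by auto
  finally show ?thesis .
qed

text \<open>The index of T is prime to p, so the p-group P fixes some coset of T, and a fixed coset
  yields an element conjugating P into T.\<close>

lemma sylow_conj_aux:
  assumes fin: "finite (carrier G)" and p: "prime p"
    and P: "subgroup P G" "card P = p ^ k"
    and T: "subgroup T G" "card T = p ^ multiplicity p (order G)"
  shows "\<exists>g\<in>carrier G. conjby g ` P \<subseteq> T"
proof -
  have o: "order G > 0" using fin order_gt_0_iff_finite by blast
  have "\<not> p dvd card (rcosets T)"
  proof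
    assume "p dvd card (rcosets T)"
    then have "p * p ^ multiplicity p (order G) dvd card (rcosets T) * card T"
      by (simp add: T(2) mult_dvd_mono)
    then have "p ^ Suc (multiplicity p (order G)) dvd order G"
      by (simp add: lagrange[OF T(1)])
    then show False using multiplicity_geI[of "order G" p "Suc (multiplicity p (order G))"] p o prime_gt_1_nat[OF p] by auto
  qed
  \<comment> \<open>If there were no fixed coset, their number 0 would be divisible by p.\<close>
  then have "card {X \<in> rcosets T. \<forall>u\<in>P. X #> inv u = X} \<noteq> 0"
    using coset_fixed_points_dvd[OF fin p P T(1)] by (metis dvd_0_right)
  then have "{X \<in> rcosets T. \<forall>u\<in>P. X #> inv u = X} \<noteq> {}" by (intro notI) (simp only: card.empty)
  then obtain X where X: "X \<in> rcosets T" "\<forall>u\<in>P. X #> inv u = X" by blast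
  then obtain g where g: "g \<in> carrier G" "X = T #> g" by (auto simp: RCOSETS_def)
  then have "conjby (inv g) ` P \<subseteq> T" using coset_fixed_iff[OF T(1) P(1)] X by blast
  then show ?thesis using g by (intro bexI[of _ "inv g"]) auto
qed

text \<open>Let P act on its own cosets in S. Their number is a power of p other than 1 and P itself
  is a fixed coset, so there is a second one; its representative normalises P and lies outside
  P.\<close>

lemma normalizer_grows:
  assumes fin: "finite (carrier G)" and p: "prime p"
    and S: "subgroup S G" "card S = p ^ k" and P: "subgroup P G" "P \<subset> S"
  shows "P \<subset> Nrm P \<inter> S"
proof -
  interpret S: group "subgrp G S" by (rule subgroup_imp_group[OF S(1)])
  have finS: "finite S" using fin S(1) by (meson finite_subset subgroup.subset)
  have PS: "subgroup P (subgrp G S)" using P S by (simp add: subgroup_incl psubset_imp_subset)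
  let ?E = "rcosets\<^bsub>subgrp G S\<^esub> P"
  let ?F = "{X \<in> ?E. \<forall>u\<in>P. X #>\<^bsub>subgrp G S\<^esub> inv\<^bsub>subgrp G S\<^esub> u = X}"
  have l: "card ?E * card P = p ^ k" using S.lagrange[OF PS] S(2) by (simp add: order_def)
  then have "card P dvd p ^ k" by (metis dvd_triv_right)
  then obtain j where j: "card P = p ^ j" using p divides_primepow_nat by blast
  have "card ?E \<noteq> 1"
  proof
    assume "card ?E = 1"
    then have "card P = card S" using l S(2) by simp
    then show False using P(2) finS card_subset_eq[of S P] by auto
  qed
  moreover have "card ?E dvd p ^ k" using l by (metis dvd_triv_left)
  then obtain i where "card ?E = p ^ i" using p divides_primepow_nat by blast
  ultimately have "p dvd card ?E" by (cases i) auto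
  moreover have "p dvd card ?E \<longleftrightarrow> p dvd card ?F"
    by (rule S.coset_fixed_points_dvd[OF _ p PS j PS]) (simp add: finS)
  ultimately have pF: "p dvd card ?F" by blast
  have finF: "finite ?F" using finS by (auto simp: RCOSETS_def)
  have "P \<in> ?F"
    using subgroup.subgroup_in_rcosets[OF PS S.group_axioms] S.coset_join2[OF _ PS]
      subgroup.m_inv_closed[OF PS] subgroup.mem_carrier[OF PS] by blast
  then have "card ?F > 0" using finF card_gt_0_iff by blast
  then have "card ?F \<ge> p" using pF by (rule dvd_imp_le[rotated])
  then have "card ?F > 1" using prime_gt_1_nat[OF p] by linarith
  then have "\<not> ?F \<subseteq> {P}" using card_mono[of "{P}" ?F] by auto
  then obtain X where X: "X \<in> ?F" "X \<noteq> P" by blast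
  then obtain g where g: "g \<in> S" "X = P #>\<^bsub>subgrp G S\<^esub> g" by (auto simp: RCOSETS_def)
  have gc: "g \<in> carrier G" using g S by (simp add: subgroup.mem_carrier)
  have "S.conjby (inv\<^bsub>subgrp G S\<^esub> g) ` P \<subseteq> P"
    using S.coset_fixed_iff[OF PS PS, of g] X g by auto
  then have "conjby (inv g) ` P \<subseteq> P"
    using g S(1) by (simp add: conjby_def S.conjby_def subgroup.m_inv_closed)
  then have "inv g \<in> Nrm P" using gc finite_subset[OF _ finS, of P] P
    by (intro NrmI) (auto simp: subgroup.subset)
  then have "g \<in> Nrm P"
    using subgroup.m_inv_closed[OF Nrm_subgroup[OF subgroup.subset[OF P(1)]], of "inv g"] gc by simp
  moreover have "g \<notin> P"
    using X(2) g(2) coset_join2[OF gc P(1)] by auto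
  moreover have "P \<subseteq> Nrm P" using Nrm_self P finite_subset[OF _ finS, of P] by auto
  ultimately show ?thesis using g P by blast
qed

section \<open>Sylow subgroups of a subgroup, kept as subsets of the ambient group\<close>

definition syl :: "nat \<Rightarrow> 'a set \<Rightarrow> 'a set \<Rightarrow> bool" where
  "syl p N T \<longleftrightarrow> subgroup T G \<and> T \<subseteq> N \<and> card T = p ^ multiplicity p (card N)"

lemma p_subgroup_card_le:
  assumes fin: "finite N" and p: "prime p" and N: "subgroup N G"
    and U: "subgroup U G" "U \<subseteq> N" "card U = p ^ i"
  shows "card U \<le> p ^ multiplicity p (card N)"
proof -
  have "card N \<noteq> 0" using fin subgroup.one_closed[OF N] by auto
  moreover have "p ^ i dvd card N" using subgroup_card_dvd[OF U(1) N U(2)] U(3) by simp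
  ultimately have "i \<le> multiplicity p (card N)"
    using multiplicity_geI[of "card N" p i] prime_gt_1_nat[OF p] by auto
  then show ?thesis using prime_ge_1_nat[OF p] U(3) by (simp add: power_increasing)
qed

lemma syl_exists:
  assumes fin: "finite (carrier G)" and p: "prime p" and N: "subgroup N G"
  shows "\<exists>T. syl p N T"
proof -
  interpret N: group "subgrp G N" by (rule subgroup_imp_group[OF N])
  have finN: "finite N" using fin N by (meson finite_subset subgroup.subset)
  obtain m where "card N = p ^ multiplicity p (card N) * m"
    using multiplicity_dvd[of p "card N"] by blast
  then obtain T where "subgroup T (subgrp G N)" "card T = p ^ multiplicity p (card N)"
    using sylow_thm[of p "subgrp G N"] p finN N.group_axioms by (auto simp: order_def)
  moreover from this(1) have "T \<subseteq> N" using subgroup.subset by fastforce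
  ultimately show ?thesis unfolding syl_def using incl_subgroup[OF N] by blast
qed

lemma syl_conj:
  assumes fin: "finite (carrier G)" and p: "prime p" and N: "subgroup N G" and T: "syl p N T"
    and P: "subgroup P G" "P \<subseteq> N" "card P = p ^ k"
  shows "\<exists>g\<in>N. conjby g ` P \<subseteq> T"
proof -
  interpret N: group "subgrp G N" by (rule subgroup_imp_group[OF N])
  have finN: "finite N" using fin N by (meson finite_subset subgroup.subset)
  have "\<exists>g\<in>carrier (subgrp G N). N.conjby g ` P \<subseteq> T"
    by (rule N.sylow_conj_aux[OF _ p _ P(3)])
      (use finN T P N in \<open>auto simp: syl_def order_def intro: subgroup_incl\<close>)
  then show ?thesis using N by (auto simp: N.conjby_def conjby_def)
qed

text \<open>Some element of N conjugates a Sylow subgroup P of A into T. As N normalises A, the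
  image lies in \<open>A \<inter> T\<close>, which therefore has at least the order of P, and as a
  p-subgroup of A it cannot have more.\<close>

lemma syl_intI:
  assumes fin: "finite (carrier G)" and p: "prime p" and N: "subgroup N G" and T: "syl p N T"
    and A: "subgroup A G" "A \<subseteq> N" "N \<subseteq> Nrm A"
  shows "syl p A (A \<inter> T)"
proof -
  obtain P where P: "syl p A P" using syl_exists[OF fin p A(1)] by blast
  have finN: "finite N" using fin N by (meson finite_subset subgroup.subset)
  obtain g where g: "g \<in> N" "conjby g ` P \<subseteq> T"
    using syl_conj[OF fin p N T, of P "multiplicity p (card A)"] P A unfolding syl_def by blast
  have gc: "g \<in> carrier G" using g N by (simp add: subgroup.mem_carrier)
  have "g \<in> Nrm A" "P \<subseteq> A" using g A P by (auto simp: syl_def)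
  then have "conjby g ` P \<subseteq> A \<inter> T" using g Nrm_in[of g A] by blast
  then have "card (conjby g ` P) \<le> card (A \<inter> T)"
    using finite_subset[OF A(2) finN] by (intro card_mono) auto
  then have le: "card P \<le> card (A \<inter> T)"
    using card_conjby[OF gc, of P] P by (simp add: syl_def subgroup.subset)
  have sg: "subgroup (A \<inter> T) G" using A(1) T by (simp add: syl_def subgroups_Inter_pair)
  have dA: "card (A \<inter> T) dvd card A" using subgroup_card_dvd[OF sg A(1)] by simp
  have "card (A \<inter> T) dvd card T" using subgroup_card_dvd[OF sg, of T] T by (simp add: syl_def)
  then obtain i where i: "card (A \<inter> T) = p ^ i" using T p divides_primepow_nat unfolding syl_def by metis
  have "p ^ i \<le> card P"
    using p_subgroup_card_le[OF finite_subset[OF A(2) finN] p A(1) sg _ i] P by (simp add: syl_def i)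
  then show ?thesis using le i sg P by (simp add: syl_def)
qed

text \<open>Conjugation by n sends T to another Sylow subgroup of A, which some a in A carries back
  to T.\<close>

lemma frattini:
  assumes fin: "finite (carrier G)" and p: "prime p" and A: "subgroup A G" and T: "syl p A T"
    and n: "n \<in> Nrm A"
  shows "\<exists>a\<in>A. n \<otimes> a \<in> Nrm T"
proof -
  have Tc: "T \<subseteq> carrier G" "subgroup T G" "T \<subseteq> A" using T by (auto simp: syl_def subgroup.subset)
  have nc: "n \<in> carrier G" using n by (simp add: Nrm_def)
  have "card (conjby n ` T) = p ^ multiplicity p (card A)"
    using card_conjby[OF nc Tc(1)] T by (simp add: syl_def)
  moreover have "conjby n ` T \<subseteq> A" using n Tc(3) Nrm_in by blast
  ultimately obtain a where a: "a \<in> A" "conjby a ` conjby n ` T \<subseteq> T"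
    using syl_conj[OF fin p A T conjby_subgroup[OF nc Tc(2)]] by blast
  have ac: "a \<in> carrier G" using a A by (simp add: subgroup.mem_carrier)
  have "n \<otimes> a \<in> Nrm T"
    using a(2) finite_subset[OF Tc(1) fin] Tc nc ac by (intro NrmI) (auto simp: conjby_image_conjby)
  then show ?thesis using a by blast
qed

end

section \<open>Control of fusion\<close>

context group
begin

lemma subgroup_card_p_power:
  assumes "prime p" "subgroup S G" "card S = p ^ k" "subgroup P G" "P \<subseteq> S"
  obtains i where "card P = p ^ i"
proof -
  have "card P dvd p ^ k" using subgroup_card_dvd[OF assms(4,2,5)] assms(3) by simp
  then show thesis using that assms(1) divides_primepow_nat by blast
qed

lemma Nrm_conjby:
  assumes H: "H \<subseteq> carrier G" and x: "x \<in> carrier G" and g: "g \<in> Nrm H"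
  shows "conjby x g \<in> Nrm (conjby x ` H)"
proof -
  have gc: "g \<in> carrier G" "conjby g ` H = H" using g by (auto simp: Nrm_def)
  have "conjby (conjby x g) ` conjby x ` H = conjby (x \<otimes> conjby x g) ` H"
    using x gc H by (simp add: conjby_image_conjby)
  also have "x \<otimes> conjby x g = g \<otimes> x" using x gc by (simp add: conjby_def m_assoc[symmetric])
  also have "conjby (g \<otimes> x) ` H = conjby x ` H"
    using x gc H by (simp add: conjby_image_conjby[symmetric])
  finally show ?thesis using x gc by (simp add: Nrm_def)
qed

lemma Nrm_conjby_image:
  assumes H: "H \<subseteq> carrier G" and x: "x \<in> carrier G"
  shows "Nrm (conjby x ` H) = conjby x ` Nrm H"
proof
  show "conjby x ` Nrm H \<subseteq> Nrm (conjby x ` H)" using Nrm_conjby[OF H x] by blast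
next
  show "Nrm (conjby x ` H) \<subseteq> conjby x ` Nrm H"
  proof
    fix g assume g: "g \<in> Nrm (conjby x ` H)"
    then have gc: "g \<in> carrier G" by (simp add: Nrm_def)
    have "conjby (inv x) g \<in> Nrm (conjby (inv x) ` conjby x ` H)"
      by (rule Nrm_conjby) (use H x g in auto)
    also have "conjby (inv x) ` conjby x ` H = H"
      using H x by (simp add: conjby_image_conjby conjby_image_one)
    finally have "conjby x (conjby (inv x) g) \<in> conjby x ` Nrm H" by (rule imageI)
    then show "g \<in> conjby x ` Nrm H" using x gc by simp
  qed
qed

text \<open>Some conjugate of P under N lies in T, but N normalises P, so this conjugate is P
  itself.\<close>

lemma p_normal_le_syl:
  assumes fin: "finite (carrier G)" and p: "prime p" and N: "subgroup N G" and T: "syl p N T"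
    and P: "subgroup P G" "P \<subseteq> N" "card P = p ^ k" "N \<subseteq> Nrm P"
  shows "P \<subseteq> T"
proof -
  obtain y where "y \<in> N" "conjby y ` P \<subseteq> T" using syl_conj[OF fin p N T P(1-3)] by blast
  moreover from this(1) have "conjby y ` P = P" using P(4) by (auto simp: Nrm_def)
  ultimately show ?thesis by simp
qed

text \<open>Conjugate a Sylow subgroup T of the normaliser of P into S. Since P lies in T, it moves
  into S as well; the normaliser of its image meets S in a p-subgroup containing the image of T,
  hence in a Sylow subgroup.\<close>

lemma fully_normalized_conjugate:
  assumes fin: "finite (carrier G)" and p: "prime p" and S: "syl p (carrier G) S"
    and P: "subgroup P G" "P \<subseteq> S"
  shows "\<exists>x\<in>carrier G. conjby x ` P \<subseteq> S \<and>
    syl p (Nrm (conjby x ` P)) (Nrm (conjby x ` P) \<inter> S)"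
proof -
  have Pc: "P \<subseteq> carrier G" using P subgroup.subset by blast
  have N: "subgroup (Nrm P) G" by (rule Nrm_subgroup[OF Pc])
  have cS: "subgroup S G" "card S = p ^ multiplicity p (card (carrier G))" using S by (auto simp: syl_def)
  obtain i where i: "card P = p ^ i" using subgroup_card_p_power[OF p cS P] by blast
  obtain T where T: "syl p (Nrm P) T" using syl_exists[OF fin p N] by blast
  have Ts: "subgroup T G" "T \<subseteq> Nrm P" "T \<subseteq> carrier G" using T by (auto simp: syl_def subgroup.subset)
  have PT: "P \<subseteq> T"
    using p_normal_le_syl[OF fin p N T P(1) _ i] Nrm_self[OF finite_subset[OF Pc fin] P(1)] by blast
  obtain x where x: "x \<in> carrier G" "conjby x ` T \<subseteq> S"
    using syl_conj[OF fin p subgroup_self S Ts(1,3), of "multiplicity p (card (Nrm P))"] T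
    by (auto simp: syl_def)
  let ?R = "conjby x ` P" and ?N = "conjby x ` Nrm P"
  have RN: "Nrm ?R = ?N" by (rule Nrm_conjby_image[OF Pc x(1)])
  have Ns: "subgroup ?N G" by (rule conjby_subgroup[OF x(1) N])
  have NS: "subgroup (?N \<inter> S) G" using Ns cS(1) by (rule subgroups_Inter_pair)
  obtain j where j: "card (?N \<inter> S) = p ^ j" using subgroup_card_p_power[OF p cS NS] by blast
  have finN: "finite ?N" using finite_subset[OF subgroup.subset[OF Ns] fin] .
  have "card (?N \<inter> S) \<le> p ^ multiplicity p (card ?N)"
    by (rule p_subgroup_card_le[OF finN p Ns NS _ j]) simp
  moreover have "card (conjby x ` T) \<le> card (?N \<inter> S)"
    using x(2) Ts(2) finN by (intro card_mono) auto
  moreover have "card (conjby x ` T) = p ^ multiplicity p (card ?N)"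
    using card_conjby[OF x(1) Ts(3)] card_conjby[OF x(1), of "Nrm P"] T N
    by (simp add: syl_def subgroup.subset)
  ultimately have "syl p (Nrm ?R) (Nrm ?R \<inter> S)" unfolding RN syl_def using NS by simp
  then show ?thesis using x PT by blast
qed

text \<open>Induction on the distance of P from S: a conjugation that extends to a larger subgroup
  of S is covered by the induction hypothesis. Both P and its image under g are compared with one
  conjugate R of P whose normaliser has a Sylow subgroup inside S, which makes \<open>ext\<close>
  applicable to R.\<close>

lemma normalizer_controls_fusion:
  assumes fin: "finite (carrier G)" and p: "prime p" and S: "syl p (carrier G) S"
    and ext: "\<And>Q n. subgroup Q G \<Longrightarrow> Q \<subset> S \<Longrightarrow> syl p (Nrm Q) (Nrm Q \<inter> S) \<Longrightarrow> n \<in> Nrm Q \<Longrightarrow>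
      \<exists>L m. subgroup L G \<and> Q \<subset> L \<and> L \<subseteq> S \<and> m \<in> Nrm L \<and> (\<forall>x\<in>Q. conjby n x = conjby m x)"
  shows "subgroup P G \<Longrightarrow> P \<subseteq> S \<Longrightarrow> g \<in> carrier G \<Longrightarrow> conjby g ` P \<subseteq> S \<Longrightarrow>
    \<exists>h\<in>Nrm S. \<forall>x\<in>P. conjby g x = conjby h x"
proof (induction "card S - card P" arbitrary: P g rule: less_induct)
  case less
  note P = less.prems(1,2) and g = less.prems(3,4)
  have cS: "subgroup S G" "card S = p ^ multiplicity p (card (carrier G))" "S \<subseteq> carrier G"
    using S by (auto simp: syl_def subgroup.subset)
  have finS: "finite S" using finite_subset[OF cS(3) fin] .
  have sub: "x \<in> carrier G" if "x \<in> Nrm S" for x using that by (simp add: Nrm_def)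
  show ?case
  proof (cases "P = S")
    case True
    then show ?thesis using g NrmI[OF finS cS(3)] by blast
  next
    case False
    have cP: "card P < card S" using False P(2) finS by (intro psubset_card_mono) auto
    obtain x where x: "x \<in> carrier G" "conjby x ` P \<subseteq> S"
      "syl p (Nrm (conjby x ` P)) (Nrm (conjby x ` P) \<inter> S)"
      using fully_normalized_conjugate[OF fin p S P] by blast
    define R where "R = conjby x ` P"
    have Rs: "subgroup R G" unfolding R_def by (rule conjby_subgroup[OF x(1) P(1)])
    have Rc: "R \<subseteq> carrier G" by (rule subgroup.subset[OF Rs])
    have cR: "card R = card P" unfolding R_def by (rule card_conjby[OF x(1) subgroup.subset[OF P(1)]])
    have RS: "R \<subset> S" using x(2) cR cP unfolding R_def by auto
    have sylR: "syl p (Nrm R) (Nrm R \<inter> S)" unfolding R_def by (rule x(3))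
    \<comment> \<open>The element y is split as \<open>y \<otimes> n\<close> followed by
      \<open>inv n\<close> with n in \<open>Nrm R\<close>. The first part extends to
      \<open>N_S(P')\<close>, the second, by \<open>ext\<close>, to some L above R; the induction
      hypothesis applies to both extensions.\<close>
    have claim: "\<exists>h\<in>Nrm S. \<forall>z\<in>P'. conjby y z = conjby h z"
      if P': "subgroup P' G" "P' \<subseteq> S" and y: "y \<in> carrier G" "conjby y ` P' = R" for P' y
    proof -
      have P'c: "P' \<subseteq> carrier G" by (rule subgroup.subset[OF P'(1)])
      have c: "card P' = card P" using card_conjby[OF y(1) P'c] y(2) cR by simp
      define V where "V = Nrm P' \<inter> S"
      have P'V: "P' \<subset> V" unfolding V_def
        by (rule normalizer_grows[OF fin p cS(1,2) P'(1)]) (use P'(2) c cP in auto)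
      have Vs: "subgroup V G" unfolding V_def
        by (rule subgroups_Inter_pair[OF Nrm_subgroup[OF P'c] cS(1)])
      have Vc: "V \<subseteq> carrier G" by (rule subgroup.subset[OF Vs])
      obtain i where i: "card V = p ^ i"
        using subgroup_card_p_power[OF p cS(1,2) Vs] unfolding V_def by blast
      have yV: "conjby y ` V \<subseteq> Nrm R"
        using Nrm_conjby[OF P'c y(1)] unfolding V_def y(2) by blast
      \<comment> \<open>The image of V under y is a p-group normalising R, so Sylow's theorem in
        \<open>Nrm R\<close> moves it into S.\<close>
      obtain n where n: "n \<in> Nrm R" "conjby n ` conjby y ` V \<subseteq> Nrm R \<inter> S"
        using syl_conj[OF fin p Nrm_subgroup[OF Rc] sylR conjby_subgroup[OF y(1) Vs] yV, of i]
          card_conjby[OF y(1) Vc] i by auto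
      have nc: "n \<in> carrier G" using n by (simp add: Nrm_def)
      have "card S - card V < card S - card P"
        using psubset_card_mono[OF finite_subset[OF Vc fin] P'V] c cP by simp
      moreover have "V \<subseteq> S" "y \<otimes> n \<in> carrier G" unfolding V_def using y(1) nc by auto
      moreover have "conjby (y \<otimes> n) ` V \<subseteq> S" using n(2) conjby_image_conjby[OF y(1) nc Vc] by simp
      ultimately obtain h1 where h1: "h1 \<in> Nrm S" "\<forall>z\<in>V. conjby (y \<otimes> n) z = conjby h1 z"
        using less.hyps[of V "y \<otimes> n"] Vs by blast
      have invn: "inv n \<in> Nrm R" using subgroup.m_inv_closed[OF Nrm_subgroup[OF Rc] n(1)] .
      obtain L m where L: "subgroup L G" "R \<subset> L" "L \<subseteq> S" "m \<in> Nrm L"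
        "\<forall>z\<in>R. conjby (inv n) z = conjby m z"
        using ext[OF Rs RS sylR invn] by (elim exE conjE)
      have "card S - card L < card S - card P"
        using psubset_card_mono[OF finite_subset[OF L(3) finS] L(2)] cR cP by simp
      moreover have "conjby m ` L \<subseteq> S" "m \<in> carrier G" using L(3,4) by (auto simp: Nrm_def)
      ultimately obtain h2 where h2: "h2 \<in> Nrm S" "\<forall>z\<in>L. conjby m z = conjby h2 z"
        using less.hyps[of L m] L by blast
      have "conjby y z = conjby (h1 \<otimes> h2) z" if z: "z \<in> P'" for z
      proof -
        have zc: "z \<in> carrier G" "z \<in> V" using z P'c P'V by auto
        have zR: "conjby (y \<otimes> n) z \<in> R"
          using Nrm_in[OF n(1), of "conjby y z"] y z zc nc by auto
        have "conjby y z = conjby (inv n) (conjby (y \<otimes> n) z)" using y(1) nc zc by (simp add: m_assoc)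
        also have "\<dots> = conjby h2 (conjby (y \<otimes> n) z)" using L(2,5) h2(2) zR by auto
        also have "\<dots> = conjby h2 (conjby h1 z)" using h1(2) zc by simp
        also have "\<dots> = conjby (h1 \<otimes> h2) z" using sub h1(1) h2(1) zc by simp
        finally show ?thesis .
      qed
      then show ?thesis
        using subgroup.m_closed[OF Nrm_subgroup[OF cS(3)] h1(1) h2(1)] by blast
    qed
    obtain h1 where h1: "h1 \<in> Nrm S" "\<forall>z\<in>P. conjby x z = conjby h1 z"
      using claim[OF P x(1)] unfolding R_def by blast
    have Pc: "P \<subseteq> carrier G" by (rule subgroup.subset[OF P(1)])
    \<comment> \<open>The image of P under g is also conjugate to R, through
      \<open>inv g \<otimes> x\<close>. Thus g acts on P as the map from P to R followed by the
      inverse of the map from the image to R.\<close>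
    have "conjby (inv g \<otimes> x) ` conjby g ` P = R"
      unfolding R_def using g(1) x(1) Pc by (simp add: conjby_image_conjby m_assoc[symmetric])
    then obtain h2 where h2: "h2 \<in> Nrm S" "\<forall>z\<in>conjby g ` P. conjby (inv g \<otimes> x) z = conjby h2 z"
      using claim[OF conjby_subgroup[OF g(1) P(1)] g(2), of "inv g \<otimes> x"] g(1) x(1) by blast
    have "conjby g z = conjby (h1 \<otimes> inv h2) z" if z: "z \<in> P" for z
    proof -
      have zc: "z \<in> carrier G" using z Pc by auto
      have "conjby h2 (conjby g z) = conjby (inv g \<otimes> x) (conjby g z)" using h2(2) z by auto
      also have "\<dots> = conjby x z" using g(1) x(1) zc by (simp add: m_assoc[symmetric])
      also have "\<dots> = conjby h1 z" using h1(2) z by blast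
      finally have "conjby (inv h2) (conjby h2 (conjby g z)) = conjby (inv h2) (conjby h1 z)" by simp
      then show ?thesis using sub h1(1) h2(1) g(1) zc by (simp add: m_assoc)
    qed
    moreover have "h1 \<otimes> inv h2 \<in> Nrm S"
      using Nrm_subgroup[OF cS(3)] h1(1) h2(1) by (simp add: subgroup.m_closed subgroup.m_inv_closed)
    ultimately show ?thesis by blast
  qed
qed

end

section \<open>The \<open>p\<close>-core and the supersolvable hypercenter\<close>

context group
begin

text \<open>By finiteness a maximal such subgroup exists, and closure under products makes it the
  greatest one, so \<open>GREATEST\<close> is meaningful.\<close>

lemma Greatest_normal:
  assumes fin: "finite (carrier G)" and ne: "P N0"
    and nor: "\<And>N. P N \<Longrightarrow> N \<lhd> G"
    and mult: "\<And>M N. P M \<Longrightarrow> P N \<Longrightarrow> P (M <#> N)"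
  shows "P (GREATEST N. P N)" "\<And>N. P N \<Longrightarrow> N \<subseteq> (GREATEST N. P N)"
proof -
  have "Collect P \<subseteq> Pow (carrier G)"
    using nor normal_imp_subgroup subgroup.subset by blast
  then have "finite (Collect P)" using fin finite_subset by blast
  then obtain M where M: "P M" "\<And>N. P N \<Longrightarrow> M \<subseteq> N \<Longrightarrow> M = N"
    using finite_has_maximal[of "Collect P"] ne by auto
  have "N \<subseteq> M" if N: "P N" for N
  proof -
    interpret MN: second_isomorphism_grp M G N
      using nor[OF M(1)] normal_imp_subgroup[OF nor[OF N]]
      by (simp add: second_isomorphism_grp_def second_isomorphism_grp_axioms_def)
    have "M = M <#> N" using M(2)[OF mult[OF M(1) N]] MN.H_contained_in_set_mult by blast
    then show ?thesis using MN.S_contained_in_set_mult by blast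
  qed
  then have "(GREATEST N. P N) = M" using M(1) by (intro Greatest_equality) auto
  then show "P (GREATEST N. P N)" "\<And>N. P N \<Longrightarrow> N \<subseteq> (GREATEST N. P N)"
    using M(1) \<open>\<And>N. P N \<Longrightarrow> N \<subseteq> M\<close> by auto
qed

lemma normal_Nrm: "finite (carrier G) \<Longrightarrow> N \<lhd> G \<Longrightarrow> carrier G = Nrm N"
proof -
  assume fin: "finite (carrier G)" and N: "N \<lhd> G"
  have Nc: "N \<subseteq> carrier G" using N by (simp add: normal_imp_subgroup subgroup.subset)
  have "g \<in> Nrm N" if g: "g \<in> carrier G" for g
    by (rule NrmI[OF finite_subset[OF Nc fin] Nc g])
      (use normal.inv_op_closed1[OF N g] in \<open>auto simp: conjby_def\<close>)
  then show ?thesis by (auto simp: Nrm_def)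
qed

text \<open>All normal p-subgroups lie in one Sylow subgroup T, so their products lie in T too and
  are again p-groups.\<close>

lemma p_core_Greatest:
  assumes fin: "finite (carrier G)" and p: "prime p"
  defines "P \<equiv> \<lambda>N. N \<lhd> G \<and> p_group p (subgrp G N)"
  shows "P (p_core p G)" "\<And>N. P N \<Longrightarrow> N \<subseteq> p_core p G"
proof -
  obtain T where T: "syl p (carrier G) T" using syl_exists[OF fin p subgroup_self] by blast
  then have Ts: "subgroup T G" "card T = p ^ multiplicity p (card (carrier G))" by (auto simp: syl_def)
  have le: "N \<subseteq> T" if "P N" for N
  proof -
    have N: "N \<lhd> G" "subgroup N G" using that normal_imp_subgroup by (auto simp: P_def)
    have "\<exists>k. order (subgrp G N) = p ^ k" using that unfolding P_def p_group_def by blast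
    then obtain k where "card N = p ^ k" by (auto simp: order_def)
    then show ?thesis
      using p_normal_le_syl[OF fin p subgroup_self T N(2) subgroup.subset[OF N(2)]]
        normal_Nrm[OF fin N(1)] by blast
  qed
  have one: "P {\<one>}"
    using one_is_normal subgroup_imp_group[OF normal_imp_subgroup[OF one_is_normal]]
    by (auto simp: P_def p_group_def order_def intro!: exI[of _ 0])
  have mult: "P (M <#> N)" if "P M" "P N" for M N
  proof -
    have nor: "M <#> N \<lhd> G" using that normal_subgroup_set_mult_closed by (auto simp: P_def)
    have "M <#> N \<subseteq> T"
      using le[OF that(1)] le[OF that(2)] subgroup.m_closed[OF Ts(1)] by (auto simp: set_mult_def)
    then obtain i where "card (M <#> N) = p ^ i"
      using subgroup_card_p_power[OF p Ts normal_imp_subgroup[OF nor]] by blast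
    then show ?thesis using nor subgroup_imp_group[OF normal_imp_subgroup[OF nor]]
      by (auto simp: P_def p_group_def order_def)
  qed
  show "P (p_core p G)" "\<And>N. P N \<Longrightarrow> N \<subseteq> p_core p G"
    using Greatest_normal[of P, OF fin one _ mult] unfolding p_core_def P_def by auto
qed

lemma p_core_normal: "finite (carrier G) \<Longrightarrow> prime p \<Longrightarrow> p_core p G \<lhd> G"
  using p_core_Greatest(1) by blast

lemma p_core_card: "finite (carrier G) \<Longrightarrow> prime p \<Longrightarrow> \<exists>k. card (p_core p G) = p ^ k"
  using p_core_Greatest(1) by (auto simp: p_group_def order_def)

lemma le_p_core:
  "finite (carrier G) \<Longrightarrow> prime p \<Longrightarrow> N \<lhd> G \<Longrightarrow> card N = p ^ k \<Longrightarrow> N \<subseteq> p_core p G"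
  using p_core_Greatest(2) subgroup_imp_group[OF normal_imp_subgroup]
  by (auto simp: p_group_def order_def)

text \<open>The isomorphism between \<open>Y X / Y\<close> and \<open>X / (Y \<inter> X)\<close> is
  compatible with normality in G: intermediate normal subgroups correspond through
  \<open>L \<mapsto> Y L\<close> and \<open>L \<mapsto> L \<inter> X\<close>.\<close>

lemma chief_factor_isom:
  assumes X: "X \<lhd> G" and Y: "Y \<lhd> G"
  shows "chief_factor G (Y <#> X) Y \<longleftrightarrow> chief_factor G X (Y \<inter> X)"
    and "cyclic_group (subgrp G (Y <#> X) Mod Y) \<longleftrightarrow> cyclic_group (subgrp G X Mod (Y \<inter> X))"
proof -
  note Xs = normal_imp_subgroup[OF X] and Ys = normal_imp_subgroup[OF Y]
  interpret YX: second_isomorphism_grp Y G X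
    by (intro second_isomorphism_grp.intro second_isomorphism_grp_axioms.intro Y Xs)
  note le = YX.H_contained_in_set_mult YX.S_contained_in_set_mult
  have sub: "x \<in> carrier G" if "x \<in> X \<or> x \<in> Y" for x
    using that subgroup.mem_carrier[OF Xs] subgroup.mem_carrier[OF Ys] by blast
  have YXn: "Y <#> X \<lhd> G" by (rule normal_subgroup_set_mult_closed[OF Y X])
  have YXi: "Y \<inter> X \<lhd> G" by (rule normal_subgroup_intersect[OF Y X])
  have prod: "Y <#> L \<subseteq> M" if "subgroup M G" "Y \<subseteq> M" "L \<subseteq> M" for L M
    using that subgroup.m_closed[OF that(1)] by (auto simp: set_mult_def)
  \<comment> \<open>The modular law for elements: if z = y l and one of the two factors lie in K, so
    does the other. It shows that neither correspondence collapses a proper inclusion.\<close>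
  have decomp: "z \<in> M" if "z \<in> Y <#> L" "L \<subseteq> X" "subgroup K G" "z \<in> K" "L \<subseteq> K \<or> Y \<subseteq> K"
    "Y \<inter> K \<subseteq> M" "L \<inter> K \<subseteq> M" "subgroup M G" for z L K M
  proof -
    obtain y l where yl: "y \<in> Y" "l \<in> L" "z = y \<otimes> l" using \<open>z \<in> Y <#> L\<close> by (auto simp: set_mult_def)
    have c: "y \<in> carrier G" "l \<in> carrier G" using yl sub that(2) by auto
    have e: "inv y \<otimes> z = l" "z \<otimes> inv l = y"
      using c unfolding yl(3) by (simp_all add: m_assoc) (simp add: m_assoc[symmetric])
    have "l \<in> K" if "y \<in> K"
      using subgroup.m_closed[OF \<open>subgroup K G\<close> subgroup.m_inv_closed[OF \<open>subgroup K G\<close> that] \<open>z \<in> K\<close>] e by simp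
    moreover have "y \<in> K" if "l \<in> K"
      using subgroup.m_closed[OF \<open>subgroup K G\<close> \<open>z \<in> K\<close> subgroup.m_inv_closed[OF \<open>subgroup K G\<close> that]] e by simp
    ultimately have "y \<in> K \<and> l \<in> K" using that(5) yl by blast
    then have "y \<in> M \<and> l \<in> M" using that(6,7) yl by blast
    then show ?thesis using yl(3) subgroup.m_closed[OF that(8)] by blast
  qed
  show "chief_factor G (Y <#> X) Y \<longleftrightarrow> chief_factor G X (Y \<inter> X)"
  proof
    assume c: "chief_factor G (Y <#> X) Y"
    have "\<not> X \<subseteq> Y" using c prod[OF Ys, of X] by (auto simp: chief_factor_def)
    moreover have False if L: "L \<lhd> G" "Y \<inter> X \<subset> L" "L \<subset> X" for L
    proof -
      have Ls: "subgroup L G" using L(1) by (rule normal_imp_subgroup)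
      interpret YL: second_isomorphism_grp Y G L
        using Y Ls by (simp add: second_isomorphism_grp_def second_isomorphism_grp_axioms_def)
      have n: "Y <#> L \<lhd> G" by (rule normal_subgroup_set_mult_closed[OF Y L(1)])
      have "Y <#> L \<noteq> Y" using L YL.S_contained_in_set_mult by blast
      moreover have "Y <#> L \<noteq> Y <#> X"
      proof
        assume e: "Y <#> L = Y <#> X"
        have "z \<in> L" if "z \<in> X" for z
          by (rule decomp[of z L X L]) (use that e le(2) L(2,3) Xs Ls in \<open>blast+\<close>)
        then show False using L by blast
      qed
      moreover have "Y <#> L \<subseteq> Y <#> X" using L by (intro mono_set_mult) auto
      ultimately show False
        using c n YL.H_contained_in_set_mult by (auto simp: chief_factor_def)
    qed
    ultimately show "chief_factor G X (Y \<inter> X)"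
      using X YXi by (auto simp: chief_factor_def)
  next
    assume c: "chief_factor G X (Y \<inter> X)"
    have "Y \<noteq> Y <#> X" using c le by (auto simp: chief_factor_def)
    moreover have False if L: "L \<lhd> G" "Y \<subset> L" "L \<subset> Y <#> X" for L
    proof -
      have Ls: "subgroup L G" using L(1) by (rule normal_imp_subgroup)
      have n: "L \<inter> X \<lhd> G" by (rule normal_subgroup_intersect[OF L(1) X])
      have "\<not> X \<subseteq> L" using L prod[OF Ls, of X] by blast
      moreover have "L \<inter> X \<noteq> Y \<inter> X"
      proof
        assume e: "L \<inter> X = Y \<inter> X"
        have "z \<in> Y" if "z \<in> L" for z
          by (rule decomp[of z X L Y]) (use that e L(2,3) Ls Ys in \<open>blast+\<close>)
        then show False using L by blast
      qed
      ultimately show False using c n L(2) unfolding chief_factor_def by blast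
    qed
    ultimately show "chief_factor G (Y <#> X) Y"
      using Y YXn le(1) by (auto simp: chief_factor_def)
  qed
  have g: "group (subgrp G (Y <#> X) Mod Y)" "group (subgrp G X Mod (Y \<inter> X))"
    using normal.factorgroup_is_group[OF normal_restrict_supergroup[OF YX.normal_set_mult_subgroup Y le(1)]]
      normal.factorgroup_is_group[OF normal_restrict_supergroup[OF Xs YXi]] by auto
  have "subgrp G X Mod (Y \<inter> X) \<cong> subgrp G (Y <#> X) Mod Y"
    by (rule is_isoI[OF YX.normal_intersection_quotient_isom])
  then show "cyclic_group (subgrp G (Y <#> X) Mod Y) \<longleftrightarrow> cyclic_group (subgrp G X Mod (Y \<inter> X))"
    using isomorphic_group_cyclicity g by metis
qed

text \<open>The chief factor H/K is moved below N1 or N2. If \<open>H \<inter> N1\<close> is not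
  contained in K, then H is the product of K and \<open>H \<inter> N1\<close>, and H/K is isomorphic
  to a factor below N1. Otherwise \<open>N1 K \<inter> H = K\<close>, so H/K is isomorphic to
  \<open>N1 K H / N1 K\<close>, and this in turn to a factor below N2.\<close>

lemma supersolvably_embedded_mult:
  assumes N1: "N1 \<lhd> G" "\<And>H K. chief_factor G H K \<Longrightarrow> H \<subseteq> N1 \<Longrightarrow> cyclic_group (subgrp G H Mod K)"
    and N2: "N2 \<lhd> G" "\<And>H K. chief_factor G H K \<Longrightarrow> H \<subseteq> N2 \<Longrightarrow> cyclic_group (subgrp G H Mod K)"
    and HK: "chief_factor G H K" "H \<subseteq> N1 <#> N2"
  shows "cyclic_group (subgrp G H Mod K)"
proof -
  have n: "H \<lhd> G" "K \<lhd> G" "K \<subset> H" using HK(1) by (auto simp: chief_factor_def)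
  have s: "subgroup H G" "subgroup K G" "subgroup N1 G" "subgroup N2 G"
    using n(1,2) N1(1) N2(1) normal_imp_subgroup by blast+
  have si: "second_isomorphism_grp A G B" if "A \<lhd> G" "B \<lhd> G" for A B
    using that normal_imp_subgroup by (simp add: second_isomorphism_grp_def second_isomorphism_grp_axioms_def)
  note leA = second_isomorphism_grp.H_contained_in_set_mult[OF si]
    and leB = second_isomorphism_grp.S_contained_in_set_mult[OF si]
  have prod: "A <#> B \<subseteq> M" if "subgroup M G" "A \<subseteq> M" "B \<subseteq> M" for A B M
    using that subgroup.m_closed[OF that(1)] by (auto simp: set_mult_def)
  show ?thesis
  proof (cases "H \<inter> N1 \<subseteq> K")
    case False
    let ?X = "H \<inter> N1"
    have X: "?X \<lhd> G" by (rule normal_subgroup_intersect[OF n(1) N1(1)])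
    have "K <#> ?X \<lhd> G" by (rule normal_subgroup_set_mult_closed[OF n(2) X])
    moreover have "K <#> ?X \<subseteq> H" using n by (intro prod[OF s(1)]) auto
    moreover have "K \<subset> K <#> ?X" using leA[OF n(2) X] leB[OF n(2) X] False by blast
    ultimately have e: "K <#> ?X = H" using HK(1) unfolding chief_factor_def by blast
    have "chief_factor G ?X (K \<inter> ?X)" using chief_factor_isom(1)[OF X n(2)] e HK(1) by simp
    then have "cyclic_group (subgrp G ?X Mod (K \<inter> ?X))" by (rule N1(2)) simp
    then show ?thesis using chief_factor_isom(2)[OF X n(2)] e by simp
  next
    case True
    let ?Y = "N1 <#> K"
    have Y: "?Y \<lhd> G" by (rule normal_subgroup_set_mult_closed[OF N1(1) n(2)])
    have Ys: "subgroup ?Y G" using Y by (rule normal_imp_subgroup)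
    have YH: "?Y \<inter> H = K"
    proof
      show "K \<subseteq> ?Y \<inter> H" using leB[OF N1(1) n(2)] n by blast
      show "?Y \<inter> H \<subseteq> K"
      proof
        fix h assume h: "h \<in> ?Y \<inter> H"
        then obtain a k where ak: "a \<in> N1" "k \<in> K" "h = a \<otimes> k" by (auto simp: set_mult_def)
        have c: "a \<in> carrier G" "k \<in> carrier G" using ak s by (auto dest: subgroup.mem_carrier)
        have "a = h \<otimes> inv k" using c ak by (simp add: m_assoc)
        also have "\<dots> \<in> H" using h ak n s by (meson IntD2 psubsetD subgroup.m_closed subgroup.m_inv_closed)
        finally have "a \<in> K" using ak True by blast
        then show "h \<in> K" using ak s by (simp add: subgroup.m_closed)
      qed
    qed
    let ?H = "?Y <#> H"
    have H': "?H \<lhd> G" by (rule normal_subgroup_set_mult_closed[OF Y n(1)])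
    have c1: "chief_factor G ?H ?Y" using chief_factor_isom(1)[OF n(1) Y] YH HK(1) by simp
    have c2: "cyclic_group (subgrp G ?H Mod ?Y) \<longleftrightarrow> cyclic_group (subgrp G H Mod K)"
      using chief_factor_isom(2)[OF n(1) Y] YH by simp
    have N12: "subgroup (N1 <#> N2) G"
      by (rule normal_imp_subgroup[OF normal_subgroup_set_mult_closed[OF N1(1) N2(1)]])
    have H'le: "?H \<subseteq> N1 <#> N2"
      by (intro prod N12) (use HK(2) n leA[OF N1(1) N2(1)] in auto)
    let ?X = "?H \<inter> N2"
    have X: "?X \<lhd> G" by (rule normal_subgroup_intersect[OF H' N2(1)])
    \<comment> \<open>In h = a b with a in N1 and b in N2, the factor a lies in \<open>?Y\<close>
      and hence in \<open>?H\<close>, so b lies in \<open>?H\<close> too.\<close>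
    have "?H \<subseteq> ?Y <#> ?X"
    proof
      fix h assume h: "h \<in> ?H"
      then have "h \<in> N1 <#> N2" using H'le by blast
      then obtain a b where ab: "a \<in> N1" "b \<in> N2" "h = a \<otimes> b" by (auto simp: set_mult_def)
      have c: "a \<in> carrier G" "b \<in> carrier G" using ab s by (auto dest: subgroup.mem_carrier)
      have aY: "a \<in> ?Y" using leA[OF N1(1) n(2)] ab by blast
      then have aH: "a \<in> ?H" using leA[OF Y n(1)] by blast
      have "b = inv a \<otimes> h" using c ab by (simp add: m_assoc[symmetric])
      also have "\<dots> \<in> ?H" using aH h normal_imp_subgroup[OF H']
        by (simp add: subgroup.m_closed subgroup.m_inv_closed)
      finally have "b \<in> ?X" using ab by simp
      then show "h \<in> ?Y <#> ?X" using aY unfolding ab(3) set_mult_def[of G ?Y ?X] by blast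
    qed
    moreover have "?Y <#> ?X \<subseteq> ?H"
      by (rule prod[OF normal_imp_subgroup[OF H'] leA[OF Y n(1)]]) simp
    ultimately have e: "?Y <#> ?X = ?H" by blast
    have "chief_factor G ?X (?Y \<inter> ?X)" using chief_factor_isom(1)[OF X Y] e c1 by simp
    then have "cyclic_group (subgrp G ?X Mod (?Y \<inter> ?X))" by (rule N2(2)) simp
    then show ?thesis using chief_factor_isom(2)[OF X Y] e c2 by simp
  qed
qed

text \<open>Products preserve the defining property by the previous lemma, and it holds vacuously
  for the trivial subgroup, below which there are no chief factors.\<close>

lemma supersolvable_hypercenter_Greatest:
  assumes fin: "finite (carrier G)"
  shows "supersolvable_hypercenter G \<lhd> G"
    and "chief_factor G H K \<Longrightarrow> H \<subseteq> supersolvable_hypercenter G \<Longrightarrow> cyclic_group (subgrp G H Mod K)"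
proof -
  let ?P = "\<lambda>N. N \<lhd> G \<and> (\<forall>H K. chief_factor G H K \<and> H \<subseteq> N \<longrightarrow> cyclic_group (subgrp G H Mod K))"
  have "\<not> H \<subseteq> {\<one>}" if "chief_factor G H K" for H K
    using that subgroup.one_closed[OF normal_imp_subgroup, of K G] unfolding chief_factor_def by blast
  then have one: "?P {\<one>}" using one_is_normal by blast
  have mult: "?P (M <#> N)" if M: "?P M" and N: "?P N" for M N
    using supersolvably_embedded_mult[of M N] normal_subgroup_set_mult_closed[of M N] M N by blast
  have "?P (supersolvable_hypercenter G)"
    unfolding supersolvable_hypercenter_def by (rule Greatest_normal(1)[of ?P, OF fin one _ mult]) auto
  then show "supersolvable_hypercenter G \<lhd> G"
    and "chief_factor G H K \<Longrightarrow> H \<subseteq> supersolvable_hypercenter G \<Longrightarrow> cyclic_group (subgrp G H Mod K)"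
    by auto
qed

end

section \<open>Self-centralising subgroups of \<open>p\<close>-groups\<close>

context group
begin

text \<open>Q is a proper normal subgroup of \<open>N_S(Q)\<close>; for L take the preimage of a
  subgroup of order p of the quotient.\<close>

lemma p_subgroup_extend:
  assumes fin: "finite (carrier G)" and p: "prime p"
    and S: "subgroup S G" "card S = p ^ k" and Q: "subgroup Q G" "Q \<subset> S"
  shows "\<exists>L. subgroup L G \<and> Q \<subset> L \<and> L \<subseteq> S \<and> card L = p * card Q"
proof -
  define V where "V = Nrm Q \<inter> S"
  have QV: "Q \<subset> V" unfolding V_def by (rule normalizer_grows[OF fin p S Q])
  have Vs: "subgroup V G" unfolding V_def
    by (rule subgroups_Inter_pair[OF Nrm_subgroup[OF subgroup.subset[OF Q(1)]] S(1)])
  have VS: "V \<subseteq> S" unfolding V_def by simp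
  have finV: "finite V" by (rule finite_subset[OF subgroup.subset[OF Vs] fin])
  obtain i where i: "card V = p ^ i" by (rule subgroup_card_p_power[OF p S Vs VS])
  interpret V: group "subgrp G V" by (rule subgroup_imp_group[OF Vs])
  have QsV: "subgroup Q (subgrp G V)" using subgroup_incl[OF Q(1) Vs] QV by simp
  have "Q \<lhd> subgrp G V"
  proof (rule V.normal_invI[OF QsV])
    fix x h assume "x \<in> carrier (subgrp G V)" "h \<in> Q"
    then have xh: "x \<in> V" "h \<in> Q" by auto
    have xc: "x \<in> carrier G" "inv x \<in> V" using subgroup.mem_carrier[OF Vs xh(1)] subgroup.m_inv_closed[OF Vs xh(1)] .
    then have "inv x \<in> Nrm Q" unfolding V_def by simp
    then have "conjby (inv x) h \<in> Q" using xh(2) by (rule Nrm_in)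
    then show "x \<otimes>\<^bsub>subgrp G V\<^esub> h \<otimes>\<^bsub>subgrp G V\<^esub> inv\<^bsub>subgrp G V\<^esub> x \<in> Q"
      using m_inv_consistent[OF Vs xh(1)] xc(1) by (simp add: conjby_def)
  qed
  then interpret QV: normal Q "subgrp G V" .
  let ?M = "subgrp G V Mod Q"
  have l: "order ?M * card Q = p ^ i"
    using V.lagrange[OF QsV] i by (simp add: order_def FactGroup_def)
  have "order ?M dvd p ^ i" using l by (metis dvd_triv_left)
  then obtain j where j: "order ?M = p ^ j" using p divides_primepow_nat by blast
  have "j \<noteq> 0"
  proof
    assume "j = 0"
    then have "card Q = card V" using l i j by simp
    then show False using QV psubset_card_mono[OF finV QV] by simp
  qed
  then have oM: "order ?M = p ^ 1 * p ^ (j - 1)" using j by (cases j) auto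
  have finM: "finite (carrier ?M)"
    using finV by (simp add: FactGroup_def RCOSETS_def)
  obtain A where A: "subgroup A ?M" "card A = p"
    using sylow_thm[OF p QV.factorgroup_is_group oM finM] by auto
  have Us: "subgroup (\<Union>A) (subgrp G V)" by (rule QV.factgroup_subgroup_union_subgroup[OF A(1)])
  then have Ls: "subgroup (\<Union>A) G" by (rule incl_subgroup[OF Vs])
  have AM: "A \<subseteq> rcosets\<^bsub>subgrp G V\<^esub> Q" using subgroup.subset[OF A(1)] by (simp add: FactGroup_def)
  have "card Q * card A = card (\<Union>A)"
  proof (rule card_partition)
    show "finite A" using finite_subset[OF subgroup.subset[OF A(1)] finM] .
    have "\<Union>A \<subseteq> V" using subgroup.subset[OF Us] by simp
    then show "finite (\<Union>A)" using finV by (rule finite_subset)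
    show "card c = card Q" if "c \<in> A" for c
      using V.card_rcosets_equal[of c Q] that AM subgroup.subset[OF QsV] by auto
    show "c1 \<inter> c2 = {}" if "c1 \<in> A" "c2 \<in> A" "c1 \<noteq> c2" for c1 c2
      using V.rcos_disjoint[OF QsV] that AM by (auto simp: pairwise_def disjnt_def)
  qed
  then have c: "card (\<Union>A) = p * card Q" using A(2) by (metis mult.commute)
  have "Q \<in> A" using subgroup.one_closed[OF A(1)] by simp
  then have "Q \<subseteq> \<Union>A" by blast
  moreover have "\<Union>A \<noteq> Q"
  proof
    assume "\<Union>A = Q"
    then have "card Q = p * card Q" using c by simp
    moreover have "card Q \<noteq> 0"
      using finite_subset[OF subgroup.subset[OF Q(1)] fin] subgroup.one_closed[OF Q(1)] by auto
    ultimately show False using prime_gt_1_nat[OF p] by simp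
  qed
  moreover have "\<Union>A \<subseteq> S" using subgroup.subset[OF Us] VS by simp
  ultimately show ?thesis using Ls c by blast
qed

lemma p_subgroup_supergroup:
  assumes fin: "finite (carrier G)" and p: "prime p" and S: "subgroup S G" "card S = p ^ k"
  shows "subgroup Q G \<Longrightarrow> Q \<subseteq> S \<Longrightarrow> card Q = p ^ j \<Longrightarrow> j \<le> e \<Longrightarrow> e \<le> k \<Longrightarrow>
    \<exists>L. subgroup L G \<and> Q \<subseteq> L \<and> L \<subseteq> S \<and> card L = p ^ e"
proof (induction "e - j" arbitrary: Q j)
  case 0
  then show ?case by (intro exI[of _ Q]) auto
next
  case (Suc d)
  have "p ^ j < p ^ k" using Suc.prems(4,5) Suc.hyps(2) prime_gt_1_nat[OF p] by (intro power_strict_increasing) auto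
  then have "Q \<noteq> S" using Suc.prems(3) S(2) by auto
  then obtain L where L: "subgroup L G" "Q \<subset> L" "L \<subseteq> S" "card L = p * card Q"
    using p_subgroup_extend[OF fin p S Suc.prems(1)] Suc.prems(2) by blast
  have cL: "card L = p ^ Suc j" using L(4) Suc.prems(3) by simp
  have "d = e - Suc j" "Suc j \<le> e" using Suc.hyps(2) by auto
  then obtain M where "subgroup M G" "L \<subseteq> M" "M \<subseteq> S" "card M = p ^ e"
    using Suc.hyps(1)[OF _ L(1,3) cL _ Suc.prems(5)] by blast
  then show ?case using L(2) by blast
qed

lemma comm_group_le_Cen:
  assumes L: "subgroup L G" "comm_group (subgrp G L)" and Q: "Q \<subseteq> L"
  shows "L \<subseteq> Cen Q"
proof
  fix g assume g: "g \<in> L"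
  have gc: "g \<in> carrier G" by (rule subgroup.mem_carrier[OF L(1) g])
  have "conjby g x = x" if x: "x \<in> Q" for x
  proof -
    have xL: "x \<in> L" using x Q by blast
    have xc: "x \<in> carrier G" by (rule subgroup.mem_carrier[OF L(1) xL])
    have "x \<otimes> g = g \<otimes> x"
      using comm_monoid.m_comm[OF comm_group.axioms(1)[OF L(2)], of x g] g xL by simp
    then show ?thesis using gc xc by (simp add: conjby_def m_assoc) (simp add: m_assoc[symmetric])
  qed
  then show "g \<in> Cen Q" using gc by (simp add: Cen_def)
qed

text \<open>A self-centralising subgroup cannot lie properly in an abelian subgroup.\<close>

lemma centric_card_gt:
  assumes fin: "finite (carrier G)" and p: "prime p" and S: "subgroup S G" "card S = p ^ k"
    and Q: "subgroup Q G" "Q \<subset> S" "Cen Q \<inter> S \<subseteq> Q" and e: "e < k"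
    and ab: "\<And>H. subgroup H G \<Longrightarrow> H \<subseteq> S \<Longrightarrow> card H = p ^ e \<or> card H = p * p ^ e \<Longrightarrow>
      comm_group (subgrp G H)"
  shows "p ^ e < card Q"
proof (rule ccontr)
  assume n: "\<not> p ^ e < card Q"
  have QS: "Q \<subseteq> S" using Q(2) by blast
  obtain j where j: "card Q = p ^ j" by (rule subgroup_card_p_power[OF p S Q(1) QS])
  have je: "j \<le> e" using n j prime_gt_1_nat[OF p] by simp
  \<comment> \<open>The second order \<open>p * p ^ e\<close> serves the case
    \<open>card Q = p ^ e\<close>, since L must contain Q properly.\<close>
  have "\<exists>L. subgroup L G \<and> Q \<subset> L \<and> L \<subseteq> S \<and> (card L = p ^ e \<or> card L = p * p ^ e)"
  proof (cases "j = e")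
    case True
    then show ?thesis using p_subgroup_extend[OF fin p S Q(1,2)] j by auto
  next
    case False
    then have "p ^ j < p ^ e" using je prime_gt_1_nat[OF p] by simp
    then show ?thesis using p_subgroup_supergroup[OF fin p S Q(1) QS j je] e j by fastforce
  qed
  then obtain L where L: "subgroup L G" "Q \<subset> L" "L \<subseteq> S" "card L = p ^ e \<or> card L = p * p ^ e"
    by blast
  have "L \<subseteq> Cen Q" by (rule comm_group_le_Cen[OF L(1) ab[OF L(1,3,4)]]) (use L(2) in blast)
  then show False using L(2,3) Q(3) by blast
qed

end

section \<open>Chief factors below the hypercenter\<close>

text \<open>Fermat's little theorem, iterated, in the form that also covers multiples of p. It will
  show that elements of p-power order act trivially on cyclic chief factors of p-power
  order.\<close>

lemma fermat_power: "prime p \<Longrightarrow> [a ^ p ^ r = a] (mod p)" for p a :: nat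
proof (induction r)
  case (Suc r)
  have "[a ^ p = a] (mod p)"
  proof (cases "p dvd a")
    case True
    then have "p dvd a ^ p" using prime_gt_0_nat[OF Suc.prems] by (metis dvd_power dvd_trans)
    then show ?thesis using True by (simp add: cong_def mod_eq_0_iff_dvd)
  next
    case False
    then have "[a ^ (p - 1) * a = 1 * a] (mod p)"
      by (intro cong_scalar_right fermat_theorem Suc.prems)
    moreover have "a ^ (p - 1) * a = a ^ p"
      using prime_gt_0_nat[OF Suc.prems] by (simp add: power_eq_if)
    ultimately show ?thesis by simp
  qed
  then have "[(a ^ p) ^ p ^ r = a ^ p ^ r] (mod p)" by (rule cong_pow)
  then show ?case unfolding power_Suc power_mult using Suc.IH[OF Suc.prems] by (rule cong_trans)
qed simp

context group
begin

section \<open>Powers and conjugation in cyclic factors\<close>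

lemma coset_conjby:
  assumes K: "K \<lhd> G" and g: "g \<in> carrier G" and uv: "u \<in> carrier G" "v \<in> carrier G"
    and e: "K #> u = K #> v"
  shows "K #> conjby g u = K #> conjby g v"
proof -
  interpret K: normal K G by (rule K)
  have "K #> conjby g u = (K #> inv g) <#> (K #> u) <#> (K #> g)"
    using g uv by (simp add: conjby_def K.rcos_sum)
  also have "\<dots> = K #> conjby g v" using g uv unfolding e by (simp add: conjby_def K.rcos_sum)
  finally show ?thesis .
qed

lemma coset_pow:
  assumes K: "K \<lhd> G" and uv: "u \<in> carrier G" "v \<in> carrier G" and e: "K #> u = K #> v"
  shows "K #> u [^] (n::nat) = K #> v [^] n"
  using normal.FactGroup_pow[OF K uv(1), of n] normal.FactGroup_pow[OF K uv(2), of n] e by simp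

lemma cyclic_factor_generator:
  assumes fin: "finite (carrier G)" and H: "subgroup H G" and K: "K \<lhd> G" "K \<subseteq> H"
    and cyc: "cyclic_group (subgrp G H Mod K)"
  shows "\<exists>y\<in>H. \<forall>x\<in>H. \<exists>n::nat. K #> x = K #> y [^] n"
proof -
  interpret H: group "subgrp G H" by (rule subgroup_imp_group[OF H])
  interpret KH: normal K "subgrp G H" by (rule normal_restrict_supergroup[OF H K])
  let ?M = "subgrp G H Mod K"
  interpret M: group ?M by (rule KH.factorgroup_is_group)
  obtain X where X: "X \<in> carrier ?M" "carrier ?M = range (\<lambda>n::int. X [^]\<^bsub>?M\<^esub> n)"
    using cyc unfolding M.cyclic_group by blast
  obtain y where y: "y \<in> H" "X = K #> y" using X(1) by (auto simp: carrier_FactGroup)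
  have o: "order (subgrp G H) > 0"
    using finite_subset[OF subgroup.subset[OF H] fin] H.order_gt_0_iff_finite by simp
  have "\<exists>n::nat. K #> x = K #> y [^] n" if x: "x \<in> H" for x
  proof -
    have "K #> x \<in> carrier ?M" using x by (auto simp: carrier_FactGroup)
    then obtain n :: int where n: "K #> x = X [^]\<^bsub>?M\<^esub> n" using X(2) by blast
    \<comment> \<open>The library's cyclic groups use integer exponents. An element of H raised to
      the order of H is trivial, so exponents may be reduced modulo that order and become natural
      numbers.\<close>
    define o' where "o' = int (order (subgrp G H))"
    define m where "m = nat (n mod o')"
    have "n = o' * (n div o') + int m" using o unfolding m_def o'_def by simp
    then have "y [^]\<^bsub>subgrp G H\<^esub> n = y [^]\<^bsub>subgrp G H\<^esub> (o' * (n div o') + int m)" by simp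
    also have "\<dots> = (y [^]\<^bsub>subgrp G H\<^esub> o') [^]\<^bsub>subgrp G H\<^esub> (n div o') \<otimes> y [^]\<^bsub>subgrp G H\<^esub> m"
      using H.int_pow_mult[of y "o' * (n div o')" "int m"] H.int_pow_pow[of y o' "n div o'"] y(1)
      by (simp add: int_pow_int)
    also have "y [^]\<^bsub>subgrp G H\<^esub> o' = \<one>"
      using H.pow_order_eq_1[of y] y(1) unfolding o'_def int_pow_int by simp
    also have "\<one> [^]\<^bsub>subgrp G H\<^esub> (n div o') = \<one>" using H.int_pow_one by simp
    finally have e: "y [^]\<^bsub>subgrp G H\<^esub> n = y [^] m"
      using subgroup.mem_carrier[OF H y(1)] nat_pow_consistent[of y m H, symmetric] by simp
    have "X [^]\<^bsub>?M\<^esub> n = K #> y [^]\<^bsub>subgrp G H\<^esub> n"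
      using KH.FactGroup_int_pow[of y n] y by simp
    then show ?thesis using n e by auto
  qed
  then show ?thesis using y(1) by blast
qed

lemma cyclic_factor_pow_distrib:
  assumes H: "subgroup H G" and K: "K \<lhd> G" "K \<subseteq> H"
    and cyc: "cyclic_group (subgrp G H Mod K)" and xy: "x \<in> H" "y \<in> H"
  shows "K #> (x \<otimes> y) [^] (n::nat) = K #> (x [^] n \<otimes> y [^] n)"
proof -
  interpret H: group "subgrp G H" by (rule subgroup_imp_group[OF H])
  interpret KH: normal K "subgrp G H" by (rule normal_restrict_supergroup[OF H K])
  let ?M = "subgrp G H Mod K"
  interpret M: group ?M by (rule KH.factorgroup_is_group)
  interpret M: comm_group ?M by (rule M.cyclic_imp_abelian_group[OF cyc])
  have q: "K #> u \<in> carrier ?M" if "u \<in> H" for u using that by (auto simp: carrier_FactGroup)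
  have qp: "(K #> u) [^]\<^bsub>?M\<^esub> n = K #> u [^] n" if "u \<in> H" for u
    using KH.FactGroup_pow[of u n] that nat_pow_consistent[of u n H] by simp
  have qm: "(K #> u) \<otimes>\<^bsub>?M\<^esub> (K #> v) = K #> (u \<otimes> v)" if "u \<in> H" "v \<in> H" for u v
    using KH.rcos_sum[of u v] that by simp
  have pw: "u [^] n \<in> H" if "u \<in> H" for u
    using H.nat_pow_closed[of u n] that nat_pow_consistent[of u n H] by simp
  have "K #> (x \<otimes> y) [^] n = ((K #> x) \<otimes>\<^bsub>?M\<^esub> (K #> y)) [^]\<^bsub>?M\<^esub> n"
    using qp[of "x \<otimes> y"] qm[OF xy] subgroup.m_closed[OF H xy] by simp
  also have "\<dots> = (K #> x) [^]\<^bsub>?M\<^esub> n \<otimes>\<^bsub>?M\<^esub> (K #> y) [^]\<^bsub>?M\<^esub> n"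
    by (rule M.nat_pow_distrib[OF q[OF xy(1)] q[OF xy(2)]])
  also have "\<dots> = K #> (x [^] n \<otimes> y [^] n)"
    using qp[OF xy(1)] qp[OF xy(2)] qm[OF pw[OF xy(1)] pw[OF xy(2)]] by simp
  finally show ?thesis .
qed

lemma subgroup_pow_closed: "subgroup H G \<Longrightarrow> x \<in> H \<Longrightarrow> x [^] (n::nat) \<in> H"
  by (induction n) (auto simp: subgroup.one_closed subgroup.m_closed)

lemma pow_p_power_eq_one:
  assumes "subgroup P G" "card P = p ^ k" "x \<in> P"
  shows "x [^] p ^ k = \<one>"
  using group.pow_order_eq_1[OF subgroup_imp_group[OF assms(1)], of x] assms(2,3)
    nat_pow_consistent[of x "p ^ k" P] by (simp add: order_def)

text \<open>As H/K is abelian, the elements of H whose p-th power lies in K form a subgroup L, which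
  is normal in G and contains K. It is larger than K because H is a p-group, so L = H by the
  definition of a chief factor.\<close>

lemma chief_factor_exponent:
  assumes p: "prime p" and chief: "chief_factor G H K" and card: "card H = p ^ k"
    and cyc: "cyclic_group (subgrp G H Mod K)" and x: "x \<in> H"
  shows "x [^] p \<in> K"
proof -
  have n: "H \<lhd> G" "K \<lhd> G" "K \<subseteq> H" "K \<noteq> H" using chief by (auto simp: chief_factor_def)
  note Hs = normal_imp_subgroup[OF n(1)] and Ks = normal_imp_subgroup[OF n(2)]
  have Hc: "u \<in> carrier G" if "u \<in> H" for u by (rule subgroup.mem_carrier[OF Hs that])
  define L where "L = {u \<in> H. u [^] p \<in> K}"
  have Ls: "subgroup L G"
  proof (rule subgroupI)
    show "L \<subseteq> carrier G" using Hc by (auto simp: L_def)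
    show "L \<noteq> {}" using subgroup.one_closed[OF Hs] subgroup.one_closed[OF Ks]
      by (auto simp: L_def intro!: exI[of _ \<one>])
    show "inv a \<in> L" if "a \<in> L" for a
      using that Hc subgroup.m_inv_closed[OF Hs] subgroup.m_inv_closed[OF Ks]
      by (simp add: L_def nat_pow_inv)
    show "a \<otimes> b \<in> L" if "a \<in> L" "b \<in> L" for a b
    proof -
      have ab: "a \<in> H" "b \<in> H" "a [^] p \<in> K" "b [^] p \<in> K" using that by (auto simp: L_def)
      have "K #> (a \<otimes> b) [^] p = K #> (a [^] p \<otimes> b [^] p)"
        by (rule cyclic_factor_pow_distrib[OF Hs n(2,3) cyc ab(1,2)])
      also have "\<dots> = K"
        using coset_join2[OF _ Ks] subgroup.m_closed[OF Ks ab(3,4)] subgroup.mem_carrier[OF Ks] by blast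
      finally have "(a \<otimes> b) [^] p \<in> K" using coset_join1[OF _ _ Ks] Hc ab(1,2) by simp
      then show ?thesis using ab subgroup.m_closed[OF Hs] by (simp add: L_def)
    qed
  qed
  have Ln: "L \<lhd> G"
  proof (rule normal_invI[OF Ls])
    fix g h assume g: "g \<in> carrier G" and h: "h \<in> L"
    then have "conjby (inv g) h \<in> H" "conjby (inv g) (h [^] p) \<in> K"
      using normal.inv_op_closed1[OF n(1), of "inv g" h] normal.inv_op_closed1[OF n(2), of "inv g" "h [^] p"]
      by (auto simp: L_def conjby_def)
    then show "g \<otimes> h \<otimes> inv g \<in> L"
      using g h Hc by (simp add: L_def conjby_pow) (simp add: conjby_def)
  qed
  have KL: "K \<subseteq> L" using n(3) subgroup_pow_closed[OF Ks] by (auto simp: L_def)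
  obtain u where u: "u \<in> H" "u \<notin> K" using n(3,4) by blast
  \<comment> \<open>In the sequence of iterated p-th powers of u, the last term before the first
    entry into K is an element of L outside K.\<close>
  have "\<exists>j. u [^] p ^ j \<in> K"
    using pow_p_power_eq_one[OF Hs card u(1)] subgroup.one_closed[OF Ks] by metis
  then obtain j where j: "u [^] p ^ j \<in> K" "\<And>i. i < j \<Longrightarrow> u [^] p ^ i \<notin> K"
    using exists_least_iff[of "\<lambda>j. u [^] p ^ j \<in> K"] by blast
  have "j \<noteq> 0" using j(1) u Hc by (cases j) auto
  then obtain i where i: "j = Suc i" by (cases j) auto
  let ?v = "u [^] p ^ i"
  have "?v [^] p = u [^] p ^ j" using Hc[OF u(1)] i by (simp add: nat_pow_pow mult.commute)
  then have "?v \<in> L" "?v \<notin> K" using j i subgroup_pow_closed[OF Hs u(1)] by (auto simp: L_def)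
  then have "K \<subset> L" using KL by blast
  then have "L = H" using chief Ln by (auto simp: chief_factor_def L_def)
  then show ?thesis using x unfolding L_def by blast
qed

text \<open>H/K is generated by a coset whose p-th power is trivial, and t raises this coset to some
  power i. Since \<open>t [^] p ^ r = \<one>\<close>, raising it to the power
  \<open>i ^ p ^ r\<close> is the identity, and by Fermat's theorem that exponent may be replaced by
  i.\<close>

lemma p_element_centralizes_chief_factor:
  assumes fin: "finite (carrier G)" and p: "prime p"
    and chief: "chief_factor G H K" and card: "card H = p ^ k"
    and cyc: "cyclic_group (subgrp G H Mod K)"
    and t: "t \<in> carrier G" "t [^] p ^ r = \<one>" and x: "x \<in> H"
  shows "K #> conjby t x = K #> x"
proof -
  have n: "H \<lhd> G" "K \<lhd> G" "K \<subseteq> H" using chief by (auto simp: chief_factor_def)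
  note Hs = normal_imp_subgroup[OF n(1)] and Ks = normal_imp_subgroup[OF n(2)]
  have Hc: "u \<in> carrier G" if "u \<in> H" for u by (rule subgroup.mem_carrier[OF Hs that])
  interpret K: normal K G by (rule n(2))
  interpret Q: group "G Mod K" by (rule K.factorgroup_is_group)
  obtain y where y: "y \<in> H" "\<And>x. x \<in> H \<Longrightarrow> \<exists>n::nat. K #> x = K #> y [^] n"
    using cyclic_factor_generator[OF fin Hs n(2,3) cyc] by blast
  have yc: "y \<in> carrier G" by (rule Hc[OF y(1)])
  have Qy: "K #> y \<in> carrier (G Mod K)" using yc by (auto simp: carrier_FactGroup)
  have Qp: "(K #> y) [^]\<^bsub>G Mod K\<^esub> p = \<one>\<^bsub>G Mod K\<^esub>"
    using K.FactGroup_pow[OF yc, of p] chief_factor_exponent[OF p chief card cyc y(1)]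
      coset_join2[OF _ Ks] yc by simp
  have red: "K #> y [^] a = K #> y [^] (a mod p)" for a :: nat
  proof -
    have "(K #> y) [^]\<^bsub>G Mod K\<^esub> (p * (a div p) + a mod p) =
        ((K #> y) [^]\<^bsub>G Mod K\<^esub> p) [^]\<^bsub>G Mod K\<^esub> (a div p) \<otimes>\<^bsub>G Mod K\<^esub> (K #> y) [^]\<^bsub>G Mod K\<^esub> (a mod p)"
      by (simp only: Q.nat_pow_mult[OF Qy] Q.nat_pow_pow[OF Qy])
    also have "\<dots> = (K #> y) [^]\<^bsub>G Mod K\<^esub> (a mod p)"
      unfolding Qp Q.nat_pow_one by (rule Q.l_one[OF Q.nat_pow_closed[OF Qy]])
    finally show ?thesis by (simp only: K.FactGroup_pow[OF yc] mult_div_mod_eq)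
  qed
  have cong: "K #> y [^] a = K #> y [^] b" if "[a = b] (mod p)" for a b :: nat
    using red[of a] red[of b] that by (simp add: cong_def)
  have "conjby t y \<in> H"
    using normal.inv_op_closed1[OF n(1) t(1) y(1)] by (simp add: conjby_def)
  then obtain i :: nat where i: "K #> conjby t y = K #> y [^] i" using y(2) by blast
  have "K #> conjby (t [^] m) y = K #> y [^] (i ^ m)" for m :: nat
  proof (induction m)
    case (Suc m)
    have "K #> conjby (t [^] Suc m) y = K #> conjby t (conjby (t [^] m) y)" using t yc by simp
    also have "\<dots> = K #> conjby t (y [^] (i ^ m))"
      by (rule coset_conjby[OF n(2) t(1) _ _ Suc]) (use t yc in auto)
    also have "\<dots> = K #> conjby t y [^] (i ^ m)" using t yc by (simp add: conjby_pow)
    also have "\<dots> = K #> (y [^] i) [^] (i ^ m)"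
      by (rule coset_pow[OF n(2) _ _ i]) (use t yc in auto)
    finally show ?case using yc by (simp add: nat_pow_pow)
  qed (use yc in simp)
  from this[of "p ^ r"] have "K #> y = K #> y [^] (i ^ p ^ r)" using t(2) yc by simp
  also have "\<dots> = K #> y [^] i" by (rule cong[OF fermat_power[OF p]])
  finally have yt: "K #> conjby t y = K #> y" using i by simp
  obtain m :: nat where m: "K #> x = K #> y [^] m" using y(2)[OF x] by blast
  have "K #> conjby t x = K #> conjby t (y [^] m)"
    by (rule coset_conjby[OF n(2) t(1) Hc[OF x] _ m]) (use yc in simp)
  also have "\<dots> = K #> conjby t y [^] m" using t yc by (simp add: conjby_pow)
  also have "\<dots> = K #> y [^] m" by (rule coset_pow[OF n(2) _ yc yt]) (use t yc in auto)
  finally show ?thesis using m by simp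
qed

section \<open>Elements acting trivially on the chief factors below Q\<close>

lemma exists_chief_factor_below:
  assumes fin: "finite (carrier G)" and M: "M \<lhd> G" "M \<noteq> {\<one>}"
  shows "\<exists>K. chief_factor G M K"
proof -
  let ?C = "{K. K \<lhd> G \<and> K \<subset> M}"
  have Ms: "subgroup M G" by (rule normal_imp_subgroup[OF M(1)])
  have "?C \<subseteq> Pow M" by blast
  then have "finite ?C"
    by (rule finite_subset) (simp add: finite_subset[OF subgroup.subset[OF Ms] fin])
  moreover have "{\<one>} \<in> ?C" using one_is_normal M(2) subgroup.one_closed[OF Ms] by auto
  ultimately have "\<exists>K\<in>?C. \<forall>L\<in>?C. K \<subseteq> L \<longrightarrow> K = L" by (intro finite_has_maximal) auto
  then obtain K where K: "K \<lhd> G" "K \<subset> M" "\<forall>L\<in>?C. K \<subseteq> L \<longrightarrow> K = L" by blast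
  then have "chief_factor G M K" using M(1) unfolding chief_factor_def by auto
  then show ?thesis by blast
qed

text \<open>The intersection of the centralisers of the factors H/K, phrased with cosets in G so
  that no action on quotient groups has to be set up.\<close>

definition chief_centralizer :: "'a set \<Rightarrow> 'a set" where
  "chief_centralizer Q = {a \<in> carrier G. \<forall>H K. chief_factor G H K \<and> H \<subseteq> Q \<longrightarrow>
     (\<forall>x\<in>H. K #> conjby a x = K #> x)}"

lemma normal_conjby: "N \<lhd> G \<Longrightarrow> g \<in> carrier G \<Longrightarrow> x \<in> N \<Longrightarrow> conjby g x \<in> N"
  using normal.inv_op_closed1[of N G g x] by (simp add: conjby_def)

lemma normalI_conjby:
  assumes N: "subgroup N G" and c: "\<And>g x. g \<in> carrier G \<Longrightarrow> x \<in> N \<Longrightarrow> conjby g x \<in> N"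
  shows "N \<lhd> G"
proof (rule normal_invI[OF N])
  fix g h assume "g \<in> carrier G" "h \<in> N"
  then have "conjby (inv g) h \<in> N" by (intro c) auto
  then show "g \<otimes> h \<otimes> inv g \<in> N" using \<open>g \<in> carrier G\<close> by (simp add: conjby_def)
qed

lemma chief_centralizerD:
  "a \<in> chief_centralizer Q \<Longrightarrow> chief_factor G H K \<Longrightarrow> H \<subseteq> Q \<Longrightarrow> x \<in> H \<Longrightarrow> K #> conjby a x = K #> x"
  unfolding chief_centralizer_def by blast

lemma chief_factor_carrier:
  assumes "chief_factor G H K" "x \<in> H"
  shows "x \<in> carrier G"
proof -
  have "H \<lhd> G" using assms(1) unfolding chief_factor_def by blast
  then show ?thesis by (rule subgroup.mem_carrier[OF normal_imp_subgroup assms(2)])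
qed

lemma chief_centralizer_normal: "chief_centralizer Q \<lhd> G"
proof -
  let ?A = "chief_centralizer Q"
  have Ac: "a \<in> carrier G" if "a \<in> ?A" for a using that by (simp add: chief_centralizer_def)
  have nor: "H \<lhd> G" "K \<lhd> G" if "chief_factor G H K" for H K
    using that unfolding chief_factor_def by blast+
  have As: "subgroup ?A G"
  proof (rule subgroupI)
    show "?A \<subseteq> carrier G" using Ac by blast
    show "?A \<noteq> {}"
      using chief_factor_carrier by (auto simp: chief_centralizer_def intro!: exI[of _ \<one>])
  next
    fix a assume a: "a \<in> ?A"
    have "K #> conjby (inv a) x = K #> x" if hk: "chief_factor G H K" "H \<subseteq> Q" "x \<in> H" for H K x
    proof -
      have "conjby (inv a) x \<in> H" using Ac[OF a] hk(3) by (intro normal_conjby nor(1)[OF hk(1)]) auto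
      then have "K #> conjby a (conjby (inv a) x) = K #> conjby (inv a) x"
        by (rule chief_centralizerD[OF a hk(1,2)])
      then show ?thesis using Ac[OF a] chief_factor_carrier[OF hk(1,3)] by simp
    qed
    then show "inv a \<in> ?A" using Ac[OF a] unfolding chief_centralizer_def by blast
  next
    fix a b assume a: "a \<in> ?A" and b: "b \<in> ?A"
    have "K #> conjby (a \<otimes> b) x = K #> x" if hk: "chief_factor G H K" "H \<subseteq> Q" "x \<in> H" for H K x
    proof -
      have "conjby a x \<in> H" using Ac[OF a] hk(3) by (intro normal_conjby nor(1)[OF hk(1)])
      then have "K #> conjby b (conjby a x) = K #> conjby a x"
        by (rule chief_centralizerD[OF b hk(1,2)])
      also have "\<dots> = K #> x" by (rule chief_centralizerD[OF a hk])
      finally show ?thesis using Ac[OF a] Ac[OF b] chief_factor_carrier[OF hk(1,3)] by simp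
    qed
    then show "a \<otimes> b \<in> ?A" using Ac[OF a] Ac[OF b] unfolding chief_centralizer_def by blast
  qed
  show ?thesis
  proof (rule normalI_conjby[OF As])
    fix g a assume g: "g \<in> carrier G" and a: "a \<in> ?A"
    have "K #> conjby (conjby g a) x = K #> x" if hk: "chief_factor G H K" "H \<subseteq> Q" "x \<in> H" for H K x
    proof -
      have xc: "x \<in> carrier G" by (rule chief_factor_carrier[OF hk(1,3)])
      let ?y = "conjby (inv g) x"
      have y: "?y \<in> H" using g hk(3) by (intro normal_conjby nor(1)[OF hk(1)]) auto
      \<comment> \<open>Conjugation by \<open>conjby g a\<close> is composed of the conjugations by
        \<open>inv g\<close>, a and g, and the middle one is trivial modulo K.\<close>
      have "conjby (conjby g a) x = conjby g (conjby a ?y)"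
        using g Ac[OF a] xc by (simp add: conjby_def m_assoc inv_mult_group)
      also have "K #> \<dots> = K #> conjby g ?y"
        by (rule coset_conjby[OF nor(2)[OF hk(1)] g _ _ chief_centralizerD[OF a hk(1,2) y]])
          (use g Ac[OF a] xc in auto)
      also have "conjby g ?y = x" using g xc by simp
      finally show ?thesis .
    qed
    then show "conjby g a \<in> ?A" using g Ac[OF a] unfolding chief_centralizer_def by blast
  qed
qed

text \<open>Each application of b multiplies x by another z, because b fixes z. So a power of b that
  makes z trivial fixes x.\<close>

lemma conjby_stable_pow:
  assumes b: "b \<in> carrier G" and x: "x \<in> carrier G" and z: "z \<in> carrier G"
    and bx: "conjby b x = z \<otimes> x" and bz: "conjby b z = z"
  shows "conjby (b [^] (m::nat)) x = z [^] m \<otimes> x"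
proof (induction m)
  case (Suc m)
  have "conjby (b [^] Suc m) x = conjby b (conjby (b [^] m) x)" using b x by simp
  also have "\<dots> = conjby b (z [^] m \<otimes> x)" unfolding Suc ..
  also have "\<dots> = z [^] m \<otimes> (z \<otimes> x)" using b x z bx bz by (simp add: conjby_mult conjby_pow)
  finally show ?case using z x by (simp add: m_assoc)
qed (use x in simp)

text \<open>An automorphism stabilising a chain of subgroups of a \<open>p\<close>-group has \<open>p\<close>-power order.\<close>

lemma chief_centralizer_p_power:
  assumes fin: "finite (carrier G)" and p: "prime p" and Q: "subgroup Q G" "card Q = p ^ k"
    and a: "a \<in> chief_centralizer Q"
  shows "M \<lhd> G \<Longrightarrow> M \<subseteq> Q \<Longrightarrow> \<exists>j. a [^] p ^ j \<in> Cen M"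
proof (induction "card M" arbitrary: M rule: less_induct)
  case less
  have ac: "a \<in> carrier G" using a by (simp add: chief_centralizer_def)
  note Ms = normal_imp_subgroup[OF less.prems(1)]
  show ?case
  proof (cases "M = {\<one>}")
    case True
    then show ?thesis using ac by (auto simp: Cen_def)
  next
    case False
    obtain K where hk: "chief_factor G M K"
      using exists_chief_factor_below[OF fin less.prems(1) False] by blast
    then have K: "K \<lhd> G" "K \<subset> M" by (auto simp: chief_factor_def)
    note Ks = normal_imp_subgroup[OF K(1)]
    have KQ: "K \<subseteq> Q" using K(2) less.prems(2) by blast
    have "card K < card M"
      using psubset_card_mono[OF finite_subset[OF subgroup.subset[OF Ms] fin] K(2)] .
    then obtain j where j: "a [^] p ^ j \<in> Cen K" using less.hyps[OF _ K(1) KQ] by blast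
    obtain l where l: "card K = p ^ l" by (rule subgroup_card_p_power[OF p Q Ks KQ])
    \<comment> \<open>By the induction hypothesis b fixes K pointwise, and it acts trivially on M/K.
      Hence it multiplies each x in M by some z in K that it fixes, and
      \<open>z [^] card K = \<one>\<close>.\<close>
    define b where "b = a [^] p ^ j"
    have bc: "b \<in> carrier G" using ac by (simp add: b_def)
    have "b \<in> chief_centralizer Q"
      unfolding b_def by (rule subgroup_pow_closed[OF normal_imp_subgroup[OF chief_centralizer_normal] a])
    note bM = chief_centralizerD[OF this hk less.prems(2)]
    have "conjby (b [^] p ^ l) x = x" if x: "x \<in> M" for x
    proof -
      have xc: "x \<in> carrier G" by (rule subgroup.mem_carrier[OF Ms x])
      have "conjby b x \<in> K #> x"
        using rcos_self[OF conjby_closed[OF bc xc] Ks] bM[OF x] by simp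
      then obtain z where z: "z \<in> K" "conjby b x = z \<otimes> x" by (auto simp: r_coset_def)
      have zc: "z \<in> carrier G" by (rule subgroup.mem_carrier[OF Ks z(1)])
      have "conjby b z = z" using j z(1) by (simp add: Cen_def b_def)
      then have "conjby (b [^] p ^ l) x = z [^] p ^ l \<otimes> x"
        by (rule conjby_stable_pow[OF bc xc zc z(2)])
      then show ?thesis using pow_p_power_eq_one[OF Ks l z(1)] xc by simp
    qed
    then have "b [^] p ^ l \<in> Cen M" using bc by (simp add: Cen_def)
    then have "a [^] p ^ (j + l) \<in> Cen M"
      unfolding b_def by (simp add: nat_pow_pow[OF ac] power_add)
    then show ?thesis by blast
  qed
qed

text \<open>By Bezout, v is a power of \<open>v [^] m\<close>, because the order of v divides n,
  which is prime to m.\<close>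

lemma coprime_power_in_subgroup:
  assumes C: "subgroup C G" and v: "v \<in> carrier G" "v [^] (m::nat) \<in> C" "v [^] (n::nat) = \<one>"
    and cop: "coprime m n" and m: "m \<noteq> 0"
  shows "v \<in> C"
proof -
  obtain x y where "m * x = n * y + 1"
    using bezout_nat[OF m, of n] cop by auto
  then have "v = v [^] (m * x)"
    using v(1,3) nat_pow_mult[OF v(1), of "n * y" 1] nat_pow_pow[OF v(1), of n y] by simp
  also have "\<dots> \<in> C" using subgroup_pow_closed[OF C v(2), of x] nat_pow_pow[OF v(1)] by simp
  finally show ?thesis .
qed

text \<open>The orders are compared one prime at a time. This allows equality of A with a subgroup B
  to be checked on Sylow subgroups, without forming a quotient.\<close>

lemma card_dvd_of_sylows:
  assumes fin: "finite (carrier G)" and A: "subgroup A G" and B: "subgroup B G"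
    and syls: "\<And>r. prime r \<Longrightarrow> \<exists>V. syl r A V \<and> V \<subseteq> B"
  shows "card A dvd card B"
proof (rule multiplicity_le_imp_dvd)
  have pos: "card H \<noteq> 0" if "subgroup H G" for H
    using finite_subset[OF subgroup.subset[OF that] fin] subgroup.one_closed[OF that] by auto
  show "card A \<noteq> 0" by (rule pos[OF A])
  fix r :: nat assume r: "prime r"
  obtain V where V: "syl r A V" "V \<subseteq> B" using syls[OF r] by blast
  have "r ^ multiplicity r (card A) dvd card B"
    using subgroup_card_dvd[OF _ B V(2)] V(1) by (auto simp: syl_def)
  then show "multiplicity r (card A) \<le> multiplicity r (card B)"
    using multiplicity_geI[of "card B" r] pos[OF B] prime_gt_1_nat[OF r] by auto
qed

lemma Cen_normal:
  assumes Q: "Q \<lhd> G"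
  shows "Cen Q \<lhd> G"
proof (rule normalI_conjby)
  note Qs = normal_imp_subgroup[OF Q]
  show "subgroup (Cen Q) G" by (rule Cen_subgroup[OF subgroup.subset[OF Qs]])
  fix g c assume g: "g \<in> carrier G" and c: "c \<in> Cen Q"
  then have cc: "c \<in> carrier G" by (simp add: Cen_def)
  have "conjby (conjby g c) x = x" if x: "x \<in> Q" for x
  proof -
    have xc: "x \<in> carrier G" by (rule subgroup.mem_carrier[OF Qs x])
    have "conjby (inv g) x \<in> Q" using g x by (intro normal_conjby[OF Q]) auto
    then have "conjby c (conjby (inv g) x) = conjby (inv g) x" using c by (simp add: Cen_def)
    then have "conjby g (conjby c (conjby (inv g) x)) = x" using g xc by simp
    moreover have "conjby (conjby g c) x = conjby g (conjby c (conjby (inv g) x))"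
      using g cc xc by (simp add: conjby_def m_assoc inv_mult_group)
    ultimately show ?thesis by simp
  qed
  then show "conjby g c \<in> Cen Q" using g cc by (simp add: Cen_def)
qed

text \<open>Modulo the centraliser of \<open>Q\<close>, the stabiliser of the chief factors below \<open>Q\<close> is a normal
  \<open>p\<close>-subgroup containing every Sylow \<open>p\<close>-subgroup, so the Frattini argument applies.\<close>

lemma hypercentral_conjby_in_Nrm_sylow:
  assumes fin: "finite (carrier G)" and p: "prime p"
    and Q: "Q \<lhd> G" "card Q = p ^ k" "Q \<subseteq> supersolvable_hypercenter G"
    and T: "syl p (carrier G) T" and n: "n \<in> carrier G"
  shows "\<exists>m\<in>Nrm T. \<forall>x\<in>Q. conjby n x = conjby m x"
proof -
  note Qs = normal_imp_subgroup[OF Q(1)]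
  define A where "A = chief_centralizer Q"
  have An: "A \<lhd> G" unfolding A_def by (rule chief_centralizer_normal)
  note As = normal_imp_subgroup[OF An]
  have Ts: "subgroup T G" "card T = p ^ multiplicity p (card (carrier G))" using T by (auto simp: syl_def)
  \<comment> \<open>Chief factors below Q are cyclic of p-power order, so elements of the p-group T
    centralise them.\<close>
  have TA: "T \<subseteq> A"
  proof
    fix t assume t: "t \<in> T"
    have tc: "t \<in> carrier G" by (rule subgroup.mem_carrier[OF Ts(1) t])
    have "K #> conjby t x = K #> x" if hk: "chief_factor G H K" "H \<subseteq> Q" "x \<in> H" for H K x
    proof -
      have "H \<lhd> G" using hk(1) by (simp add: chief_factor_def)
      then have Hs: "subgroup H G" by (rule normal_imp_subgroup)
      obtain i where "card H = p ^ i" by (rule subgroup_card_p_power[OF p Qs Q(2) Hs hk(2)])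
      moreover have "cyclic_group (subgrp G H Mod K)"
        using supersolvable_hypercenter_Greatest(2)[OF fin hk(1)] hk(2) Q(3) by blast
      ultimately show ?thesis
        by (rule p_element_centralizes_chief_factor[OF fin p hk(1) _ _ tc pow_p_power_eq_one[OF Ts t] hk(3)])
    qed
    then show "t \<in> A" using tc unfolding A_def chief_centralizer_def by blast
  qed
  define C where "C = Cen Q"
  have Cn: "C \<lhd> G" unfolding C_def by (rule Cen_normal[OF Q(1)])
  note Cs = normal_imp_subgroup[OF Cn]
  have CA: "C \<subseteq> A"
  proof
    fix c assume c: "c \<in> C"
    then have "conjby c x = x" if "x \<in> H" "H \<subseteq> Q" for x H
      using that by (auto simp: C_def Cen_def)
    then show "c \<in> A" using c unfolding A_def C_def chief_centralizer_def Cen_def by simp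
  qed
  define B where "B = C <#> T"
  interpret CT: second_isomorphism_grp C G T
    by (intro second_isomorphism_grp.intro second_isomorphism_grp_axioms.intro Cn Ts(1))
  have Bs: "subgroup B G" unfolding B_def by (rule CT.normal_set_mult_subgroup)
  have B: "C \<subseteq> B" "T \<subseteq> B"
    unfolding B_def by (rule CT.H_contained_in_set_mult, rule CT.S_contained_in_set_mult)
  have BA: "B \<subseteq> A"
    unfolding B_def set_mult_def using CA TA subgroup.m_closed[OF As] by blast
  have sylT: "syl p A T"
  proof -
    have "syl p A (A \<inter> T)"
      by (rule syl_intI[OF fin p subgroup_self T As subgroup.subset[OF As]
            equalityD1[OF normal_Nrm[OF fin An]]])
    moreover have "A \<inter> T = T" using TA by blast
    ultimately show ?thesis by simp
  qed
  \<comment> \<open>For a prime r other than p, an r-element of A has some p-power in C and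
    therefore lies in C. So B contains a Sylow subgroup of A for every prime.\<close>
  have "card A dvd card B"
  proof (rule card_dvd_of_sylows[OF fin As Bs])
    fix r :: nat assume r: "prime r"
    show "\<exists>V. syl r A V \<and> V \<subseteq> B"
    proof (cases "r = p")
      case True
      then show ?thesis using sylT B by blast
    next
      case False
      obtain V where V: "syl r A V" using syl_exists[OF fin r As] by blast
      then have Vs: "subgroup V G" "card V = r ^ multiplicity r (card A)" "V \<subseteq> A" by (auto simp: syl_def)
      have "v \<in> C" if v: "v \<in> V" for v
      proof -
        have vc: "v \<in> carrier G" by (rule subgroup.mem_carrier[OF Vs(1) v])
        have "v \<in> chief_centralizer Q" using v Vs(3) unfolding A_def by blast
        then obtain j where j: "v [^] p ^ j \<in> C"
          using chief_centralizer_p_power[OF fin p Qs Q(2) _ Q(1)] unfolding C_def by blast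
        have "coprime (p ^ j) (r ^ multiplicity r (card A))"
          using primes_coprime[OF p r] False by simp
        then show ?thesis
          using coprime_power_in_subgroup[OF Cs vc j pow_p_power_eq_one[OF Vs(1,2) v]]
            prime_gt_0_nat[OF p] by simp
      qed
      then show ?thesis using V B(1) by blast
    qed
  qed
  moreover have finA: "finite A" by (rule finite_subset[OF subgroup.subset[OF As] fin])
  moreover have "card B > 0"
    using finite_subset[OF BA finA] subgroup.one_closed[OF Bs] card_gt_0_iff by blast
  ultimately have "B = A" using BA by (intro card_seteq dvd_imp_le)
  obtain a where a: "a \<in> A" "n \<otimes> a \<in> Nrm T"
    using frattini[OF fin p As sylT] n unfolding normal_Nrm[OF fin An] by blast
  obtain c t where ct: "c \<in> C" "t \<in> T" "a = c \<otimes> t"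
    using a(1) \<open>B = A\<close> unfolding B_def set_mult_def by blast
  have cc: "c \<in> carrier G" and tc: "t \<in> carrier G"
    using subgroup.mem_carrier[OF Cs ct(1)] subgroup.mem_carrier[OF Ts(1) ct(2)] .
  note NT = Nrm_subgroup[OF subgroup.subset[OF Ts(1)]]
  have "t \<in> Nrm T"
    using Nrm_self[OF finite_subset[OF subgroup.subset[OF Ts(1)] fin] Ts(1)] ct(2) by blast
  then have "(n \<otimes> a) \<otimes> inv t \<in> Nrm T"
    by (intro subgroup.m_closed[OF NT a(2)] subgroup.m_inv_closed[OF NT])
  then have m: "n \<otimes> c \<in> Nrm T" using n cc tc unfolding ct(3) by (simp add: m_assoc)
  have "conjby n x = conjby (n \<otimes> c) x" if x: "x \<in> Q" for x
  proof -
    have "conjby n x \<in> Q" by (rule normal_conjby[OF Q(1) n x])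
    then have "conjby c (conjby n x) = conjby n x" using ct(1) unfolding C_def Cen_def by blast
    then show ?thesis using n cc subgroup.mem_carrier[OF Qs x] by simp
  qed
  then show ?thesis using m by blast
qed

text \<open>A chief factor M/K is split off at the top; it is cyclic because M lies in the
  hypercenter, and K is treated by induction.\<close>

lemma hypercentral_series:
  assumes fin: "finite (carrier G)"
  shows "M \<lhd> G \<Longrightarrow> M \<subseteq> supersolvable_hypercenter G \<Longrightarrow>
    \<exists>(n::nat) A. A 0 = {\<one>} \<and> A n = M \<and> (\<forall>i\<le>n. A i \<lhd> G) \<and>
      (\<forall>i<n. A i \<subseteq> A (Suc i) \<and> cyclic_group (subgrp G (A (Suc i)) Mod A i))"
proof (induction "card M" arbitrary: M rule: less_induct)
  case less
  note Ms = normal_imp_subgroup[OF less.prems(1)]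
  show ?case
  proof (cases "M = {\<one>}")
    case True
    then show ?thesis using one_is_normal by (intro exI[of _ 0] exI[of _ "\<lambda>_. {\<one>}"]) auto
  next
    case False
    obtain K where hk: "chief_factor G M K"
      using exists_chief_factor_below[OF fin less.prems(1) False] by blast
    then have K: "K \<lhd> G" "K \<subset> M" by (auto simp: chief_factor_def)
    have "card K < card M"
      using psubset_card_mono[OF finite_subset[OF subgroup.subset[OF Ms] fin] K(2)] .
    moreover have "K \<subseteq> supersolvable_hypercenter G" using K(2) less.prems(2) by blast
    ultimately obtain n A where A: "A 0 = {\<one>}" "A n = K" "\<forall>i\<le>n. A i \<lhd> G"
      "\<forall>i<n. A i \<subseteq> A (Suc i) \<and> cyclic_group (subgrp G (A (Suc i)) Mod A i)"
      using less.hyps[OF _ K(1)] by blast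
    have cyc: "cyclic_group (subgrp G M Mod K)"
      by (rule supersolvable_hypercenter_Greatest(2)[OF fin hk less.prems(2)])
    define B where "B = (\<lambda>i. if i \<le> n then A i else M)"
    have "B 0 = {\<one>}" "B (Suc n) = M" "\<forall>i\<le>Suc n. B i \<lhd> G"
      using A(1,3) less.prems(1) by (auto simp: B_def)
    moreover have "B i \<subseteq> B (Suc i) \<and> cyclic_group (subgrp G (B (Suc i)) Mod B i)" if "i < Suc n" for i
    proof (cases "i = n")
      case True
      then show ?thesis using A(2) K(2) cyc by (simp add: B_def psubset_imp_subset)
    next
      case False
      then show ?thesis using that A(4) by (simp add: B_def)
    qed
    ultimately show ?thesis by blast
  qed
qed

end

section \<open>The main theorem\<close>

context group
begin

section \<open>Passing between G and its subgroups\<close>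

lemma subgrp_conjby:
  assumes "subgroup N G" "g \<in> N"
  shows "group.conjby (subgrp G N) g x = conjby g x"
  using group.conjby_def[OF subgroup_imp_group[OF assms(1)], of g x] assms by (simp add: conjby_def)

lemma subgrp_syl:
  assumes N: "subgroup N G" and T: "syl p N T"
  shows "group.syl (subgrp G N) p (carrier (subgrp G N)) T"
  using T subgroup_incl[of T N] N
  by (simp add: group.syl_def[OF subgroup_imp_group[OF N]] syl_def)

lemma normal_subgrpI:
  assumes N: "subgroup N G" and Q: "subgroup Q G" "Q \<subseteq> N" "N \<subseteq> Nrm Q"
  shows "Q \<lhd> subgrp G N"
proof -
  interpret N: group "subgrp G N" by (rule subgroup_imp_group[OF N])
  show ?thesis
  proof (rule N.normalI_conjby)
    show "subgroup Q (subgrp G N)" by (rule subgroup_incl[OF Q(1) N Q(2)])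
    fix g x assume "g \<in> carrier (subgrp G N)" "x \<in> Q"
    then show "N.conjby g x \<in> Q"
      using Q(3) Nrm_in[of g Q x] subgrp_conjby[OF N, of g x] by auto
  qed
qed

lemma subgrp_normal_le_Nrm:
  assumes fin: "finite (carrier G)" and N: "subgroup N G" and Q: "Q \<lhd> subgrp G N"
  shows "subgroup Q G" "Q \<subseteq> N" "N \<subseteq> Nrm Q"
proof -
  interpret N: group "subgrp G N" by (rule subgroup_imp_group[OF N])
  show Qs: "subgroup Q G" by (rule incl_subgroup[OF N normal_imp_subgroup[OF Q]])
  show "Q \<subseteq> N" using subgroup.subset[OF normal_imp_subgroup[OF Q]] by simp
  show "N \<subseteq> Nrm Q"
  proof
    fix g assume g: "g \<in> N"
    have "conjby g ` Q \<subseteq> Q"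
      using N.normal_conjby[OF Q, of g] g subgrp_conjby[OF N g] by auto
    then show "g \<in> Nrm Q"
      using finite_subset[OF subgroup.subset[OF Qs] fin] subgroup.subset[OF Qs] subgroup.mem_carrier[OF N g]
      by (intro NrmI)
  qed
qed

text \<open>If \<open>Q\<close> is not self-centralising, extend by \<open>Q C\<^sub>S(Q)\<close>, using the Frattini argument in
  the centraliser.\<close>

lemma extend_noncentric:
  assumes fin: "finite (carrier G)" and p: "prime p" and S: "subgroup S G"
    and Q: "subgroup Q G" "Q \<subseteq> S" and syl: "syl p (Nrm Q) (Nrm Q \<inter> S)"
    and nc: "\<not> Cen Q \<inter> S \<subseteq> Q" and n: "n \<in> Nrm Q"
  shows "\<exists>L m. subgroup L G \<and> Q \<subset> L \<and> L \<subseteq> S \<and> m \<in> Nrm L \<and> (\<forall>x\<in>Q. conjby n x = conjby m x)"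
proof -
  have Qc: "Q \<subseteq> carrier G" by (rule subgroup.subset[OF Q(1)])
  note Ns = Nrm_subgroup[OF Qc] and Cs = Cen_subgroup[OF Qc]
  have Nc: "g \<in> carrier G" if "g \<in> Nrm Q" for g using that by (simp add: Nrm_def)
  have CN: "Cen Q \<subseteq> Nrm Q" by (rule Cen_le_Nrm)
  have NC: "Nrm Q \<subseteq> Nrm (Cen Q)"
  proof
    fix g assume g: "g \<in> Nrm Q"
    have "conjby g c \<in> Cen Q" if c: "c \<in> Cen Q" for c
    proof -
      have cc: "c \<in> carrier G" using c by (simp add: Cen_def)
      have "conjby (conjby g c) x = x" if x: "x \<in> Q" for x
      proof -
        have xc: "x \<in> carrier G" using x Qc by blast
        have "conjby (inv g) x \<in> Q" by (rule Nrm_in[OF subgroup.m_inv_closed[OF Ns g] x])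
        then have "conjby c (conjby (inv g) x) = conjby (inv g) x" using c by (simp add: Cen_def)
        then have "conjby g (conjby c (conjby (inv g) x)) = x" using Nc[OF g] xc by simp
        moreover have "conjby (conjby g c) x = conjby g (conjby c (conjby (inv g) x))"
          using Nc[OF g] cc xc by (simp add: conjby_def m_assoc inv_mult_group)
        ultimately show ?thesis by simp
      qed
      then show ?thesis using Nc[OF g] cc by (simp add: Cen_def)
    qed
    then show "g \<in> Nrm (Cen Q)"
      using finite_subset[OF subgroup.subset[OF Cs] fin] subgroup.subset[OF Cs] Nc[OF g]
      by (intro NrmI) auto
  qed
  \<comment> \<open>This is \<open>C_S(Q)\<close>. It is the intersection of the Sylow subgroup
    \<open>N_S(Q)\<close> of \<open>Nrm Q\<close> with the normal subgroup \<open>Cen Q\<close>,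
    hence Sylow in \<open>Cen Q\<close>.\<close>
  define U where "U = Cen Q \<inter> S"
  have "Cen Q \<inter> (Nrm Q \<inter> S) = U" using CN unfolding U_def by blast
  then have sylU: "syl p (Cen Q) U" using syl_intI[OF fin p Ns syl Cs CN NC] by simp
  obtain c where c: "c \<in> Cen Q" "n \<otimes> c \<in> Nrm U"
    using frattini[OF fin p Cs sylU, of n] NC n by blast
  define m where "m = n \<otimes> c"
  have cc: "c \<in> carrier G" and nn: "n \<in> carrier G" using c(1) Nc[OF n] by (auto simp: Cen_def)
  have mc: "m \<in> carrier G" using cc nn by (simp add: m_def)
  have eq: "conjby n x = conjby m x" if x: "x \<in> Q" for x
  proof -
    have xc: "x \<in> carrier G" using x Qc by blast
    have "conjby c (conjby n x) = conjby n x" using c(1) Nrm_in[OF n x] unfolding Cen_def by blast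
    then show ?thesis using conjby_conjby[OF nn cc xc] unfolding m_def by simp
  qed
  have QUS: "Q \<union> U \<subseteq> S" using Q(2) by (auto simp: U_def)
  \<comment> \<open>The product Q U, given by generators: invariance under m then only has to be
    checked on Q, where m acts like n, and on U, which m normalises.\<close>
  define L where "L = generate G (Q \<union> U)"
  have QUc: "Q \<union> U \<subseteq> carrier G" using QUS subgroup.subset[OF S] by blast
  have Ls: "subgroup L G" unfolding L_def by (rule generate_is_subgroup[OF QUc])
  have QUL: "Q \<union> U \<subseteq> L" unfolding L_def by (intro subsetI generate.incl)
  have LS: "L \<subseteq> S" unfolding L_def by (rule generate_subgroup_incl[OF QUS S])
  have "conjby m x \<in> L" if x: "x \<in> Q \<union> U" for x
  proof (cases "x \<in> Q")
    case True
    then show ?thesis using eq[OF True] Nrm_in[OF n True] QUL by auto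
  next
    case False
    then show ?thesis using x Nrm_in[OF c(2), of x] QUL unfolding m_def by blast
  qed
  then have "Q \<union> U \<subseteq> {x \<in> carrier G. conjby m x \<in> L}" using QUc by blast
  \<comment> \<open>The preimage of L under conjugation by m is a subgroup, so it contains L as soon
    as it contains the generators.\<close>
  moreover have "subgroup {x \<in> carrier G. conjby m x \<in> L} G"
  proof (rule subgroupI)
    show "{x \<in> carrier G. conjby m x \<in> L} \<noteq> {}"
      using mc subgroup.one_closed[OF Ls] by (auto intro!: exI[of _ \<one>])
  qed (use mc subgroup.m_closed[OF Ls] subgroup.m_inv_closed[OF Ls] in \<open>auto simp: conjby_mult conjby_m_inv\<close>)
  ultimately have "L \<subseteq> {x \<in> carrier G. conjby m x \<in> L}"
    unfolding L_def by (rule generate_subgroup_incl)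
  then have "conjby m ` L \<subseteq> L" by blast
  then have "m \<in> Nrm L"
    using finite_subset[OF subgroup.subset[OF Ls] fin] subgroup.subset[OF Ls] mc by (intro NrmI)
  moreover have "Q \<subset> L" using QUL nc unfolding U_def by blast
  ultimately show ?thesis using Ls LS eq by blast
qed

text \<open>The larger subgroup is the core of the normaliser if it exceeds \<open>Q\<close>, and \<open>N\<^sub>S(Q)\<close> otherwise.\<close>

lemma extend_hypercentral:
  assumes fin: "finite (carrier G)" and p: "prime p" and S: "subgroup S G" "card S = p ^ k"
    and Q: "subgroup Q G" "Q \<subset> S" and syl: "syl p (Nrm Q) (Nrm Q \<inter> S)"
    and n: "n \<in> Nrm Q"
    and hyp: "p_core p (subgrp G (Nrm Q)) = Q \<Longrightarrow> Q \<subseteq> supersolvable_hypercenter (subgrp G (Nrm Q))"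
  shows "\<exists>L m. subgroup L G \<and> Q \<subset> L \<and> L \<subseteq> S \<and> m \<in> Nrm L \<and> (\<forall>x\<in>Q. conjby n x = conjby m x)"
proof -
  have Qc: "Q \<subseteq> carrier G" by (rule subgroup.subset[OF Q(1)])
  define N where "N = Nrm Q"
  define T where "T = N \<inter> S"
  have Ns: "subgroup N G" unfolding N_def by (rule Nrm_subgroup[OF Qc])
  have finN: "finite (carrier (subgrp G N))" using finite_subset[OF subgroup.subset[OF Ns] fin] by simp
  have sylT: "syl p N T" using syl unfolding N_def T_def .
  have Ts: "subgroup T G" using sylT by (simp add: syl_def)
  interpret N: group "subgrp G N" by (rule subgroup_imp_group[OF Ns])
  have QN: "Q \<subseteq> N" unfolding N_def by (rule Nrm_self[OF finite_subset[OF Qc fin] Q(1)])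
  have Qn: "Q \<lhd> subgrp G N" by (rule normal_subgrpI[OF Ns Q(1) QN]) (simp add: N_def)
  have QS: "Q \<subseteq> S" using Q(2) by blast
  obtain i where i: "card Q = p ^ i" by (rule subgroup_card_p_power[OF p S Q(1) QS])
  let ?O = "p_core p (subgrp G N)"
  have QO: "Q \<subseteq> ?O" by (rule N.le_p_core[OF finN p Qn i])
  note O = subgrp_normal_le_Nrm[OF fin Ns N.p_core_normal[OF finN p]]
  show ?thesis
  proof (cases "?O = Q")
    case False
    obtain j where j: "card ?O = p ^ j" using N.p_core_card[OF finN p] by blast
    \<comment> \<open>As a normal p-subgroup of N, the core lies in the Sylow subgroup T; it is
      normalised by n, so m = n works.\<close>
    have "?O \<subseteq> T" by (rule p_normal_le_syl[OF fin p Ns sylT O(1,2) j O(3)])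
    moreover have "n \<in> Nrm ?O" using n O(3) unfolding N_def by blast
    ultimately show ?thesis using O(1) QO False unfolding T_def by blast
  next
    case True
    then have hc: "Q \<subseteq> supersolvable_hypercenter (subgrp G N)" using hyp unfolding N_def by blast
    have nN: "n \<in> N" using n unfolding N_def .
    obtain m where m: "m \<in> N.Nrm T" "\<forall>x\<in>Q. N.conjby n x = N.conjby m x"
      using N.hypercentral_conjby_in_Nrm_sylow[OF finN p Qn i hc subgrp_syl[OF Ns sylT], of n] nN by auto
    have mN: "m \<in> N" using m(1) by (simp add: N.Nrm_def)
    have "N.conjby m ` T = T" using m(1) by (simp add: N.Nrm_def)
    then have "m \<in> Nrm T"
      using subgrp_conjby[OF Ns mN] subgroup.mem_carrier[OF Ns mN] by (simp add: Nrm_def)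
    moreover have "\<forall>x\<in>Q. conjby n x = conjby m x"
      using m(2) subgrp_conjby[OF Ns mN] subgrp_conjby[OF Ns nN] by simp
    moreover have "Q \<subset> T"
      using normalizer_grows[OF fin p S Q] unfolding T_def N_def .
    ultimately show ?thesis using Ts unfolding T_def by blast
  qed
qed

text \<open>The hypercenter of \<open>Nrm S\<close> provides a series of S with cyclic factors whose
  terms are normalised by \<open>Nrm S\<close>. Each fusion morphism agrees with conjugation by an
  element of \<open>Nrm S\<close>, so it cannot leave a term of the series.\<close>

lemma supersolvable_fusionI:
  assumes S: "subgroup S G" and fin: "finite (carrier G)"
    and ctrl: "\<And>P g. subgroup P G \<Longrightarrow> P \<subseteq> S \<Longrightarrow> g \<in> carrier G \<Longrightarrow> conjby g ` P \<subseteq> S \<Longrightarrow>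
      \<exists>h\<in>Nrm S. \<forall>x\<in>P. conjby g x = conjby h x"
    and hyp: "S \<subseteq> supersolvable_hypercenter (subgrp G (Nrm S))"
  shows "supersolvable_fusion (subgrp G S) (fusion_system G S)"
proof -
  have Sc: "S \<subseteq> carrier G" by (rule subgroup.subset[OF S])
  define N where "N = Nrm S"
  have Ns: "subgroup N G" unfolding N_def by (rule Nrm_subgroup[OF Sc])
  have finN: "finite (carrier (subgrp G N))" using finite_subset[OF subgroup.subset[OF Ns] fin] by simp
  interpret N: group "subgrp G N" by (rule subgroup_imp_group[OF Ns])
  have SN: "S \<subseteq> N" unfolding N_def by (rule Nrm_self[OF finite_subset[OF Sc fin] S])
  have Sn: "S \<lhd> subgrp G N" by (rule normal_subgrpI[OF Ns S SN]) (simp add: N_def)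
  obtain n :: nat and A where A: "A 0 = {\<one>\<^bsub>subgrp G N\<^esub>}" "A n = S" "\<forall>i\<le>n. A i \<lhd> subgrp G N"
    "\<forall>i<n. A i \<subseteq> A (Suc i) \<and> cyclic_group (subgrp (subgrp G N) (A (Suc i)) Mod A i)"
    using N.hypercentral_series[OF finN Sn] hyp unfolding N_def by blast
  \<comment> \<open>The induction runs downwards from \<open>A n = S\<close>.\<close>
  have AS: "A i \<subseteq> S" if "i \<le> n" for i
    using that
  proof (induction rule: inc_induct)
    case base then show ?case using A(2) by simp
  next
    case (step i) then show ?case using A(4) by blast
  qed
  have "strongly_closed (subgrp G S) (fusion_system G S) (A i)" if i: "i \<le> n" for i
  proof -
    have Ai: "A i \<lhd> subgrp G N" using A(3) i by blast
    note Ai = subgrp_normal_le_Nrm[OF fin Ns Ai]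
    have "\<phi> ` P \<subseteq> A i" if P: "subgroup P (subgrp G S)" "P \<subseteq> A i"
      and phi: "\<phi> \<in> fusion_system G S P (carrier (subgrp G S))" for P \<phi>
    proof -
      obtain g where g: "g \<in> carrier G" "\<phi> = (\<lambda>x\<in>P. conjby g x)" "\<phi> ` P \<subseteq> S"
        using phi by (auto simp: fusion_system_def conjby_def)
      have im: "\<phi> ` P = conjby g ` P" using g(2) by auto
      have "P \<subseteq> S" using P(2) AS[OF i] by (rule subset_trans)
      then obtain h where h: "h \<in> Nrm S" "\<forall>x\<in>P. conjby g x = conjby h x"
        using ctrl[OF incl_subgroup[OF S P(1)] _ g(1) g(3)[unfolded im]] by blast
      have "h \<in> Nrm (A i)" using h(1) Ai(3) unfolding N_def by blast
      then have "conjby g x \<in> A i" if "x \<in> P" for x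
        using h(2) that P(2) Nrm_in[of h "A i" x] by auto
      then show ?thesis unfolding im by blast
    qed
    then show ?thesis
      unfolding strongly_closed_def using subgroup_incl[OF Ai(1) S AS[OF i]] by blast
  qed
  then show ?thesis
    unfolding supersolvable_fusion_def using A(1,2,4)
    by (intro exI[of _ n] exI[of _ A]) simp
qed

end

section \<open>The two clauses of 1-eternality as rules\<close>

lemma one_eternal_subgroup:
  assumes "one_eternal R" "group G" "finite (carrier G)"
    "subgroup H G" "subgroup K G" "H \<subseteq> K" "R H G"
  shows "R H (subgrp G K)"
  using assms unfolding one_eternal_def by blast

lemma one_eternal_p_core:
  assumes "one_eternal R" "group G" "finite (carrier G)" "prime p" "p dvd order G"
    "subgroup D G" "D \<subseteq> p_core p G" "1 < card D" "card D < card (p_core p G)"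
    "\<And>H. subgroup H G \<Longrightarrow> H \<subseteq> p_core p G \<Longrightarrow> card H = card D \<Longrightarrow> R H G"
    "\<not> comm_group (subgrp G (p_core p G)) \<Longrightarrow> card D = 2 \<Longrightarrow>
      (\<And>H. subgroup H G \<Longrightarrow> H \<subseteq> p_core p G \<Longrightarrow> cyclic_group (subgrp G H) \<Longrightarrow> card H = 4 \<Longrightarrow> R H G)"
  shows "p_core p G \<subseteq> supersolvable_hypercenter G"
proof -
  have "\<exists>D. subgroup D G \<and> D \<subseteq> p_core p G \<and> 1 < card D \<and> card D < card (p_core p G) \<and>
      (\<forall>H. subgroup H G \<and> H \<subseteq> p_core p G \<and> card H = card D \<longrightarrow> R H G) \<and>
      (\<not> comm_group (subgrp G (p_core p G)) \<and> card D = 2 \<longrightarrow>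
         (\<forall>H. subgroup H G \<and> H \<subseteq> p_core p G \<and> cyclic_group (subgrp G H) \<and> card H = 4 \<longrightarrow> R H G))"
    using assms(6-11) by blast
  moreover have "(\<exists>D. subgroup D G \<and> D \<subseteq> p_core p G \<and> 1 < card D \<and> card D < card (p_core p G) \<and>
      (\<forall>H. subgroup H G \<and> H \<subseteq> p_core p G \<and> card H = card D \<longrightarrow> R H G) \<and>
      (\<not> comm_group (subgrp G (p_core p G)) \<and> card D = 2 \<longrightarrow>
         (\<forall>H. subgroup H G \<and> H \<subseteq> p_core p G \<and> cyclic_group (subgrp G H) \<and> card H = 4 \<longrightarrow> R H G)))
      \<longrightarrow> p_core p G \<subseteq> supersolvable_hypercenter G"
    using assms(1-5) unfolding one_eternal_def by simp
  ultimately show ?thesis by (rule rev_mp)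
qed

lemma comm_group_subgrp_mono:
  assumes "group G" "subgroup Q G" "Q \<subseteq> S" "comm_group (subgrp G S)"
  shows "comm_group (subgrp G Q)"
proof -
  interpret Q: group "subgrp G Q" by (rule group.subgroup_imp_group[OF assms(1,2)])
  show ?thesis
  proof (rule Q.group_comm_groupI)
    fix x y assume "x \<in> carrier (subgrp G Q)" "y \<in> carrier (subgrp G Q)"
    then have "x \<in> S" "y \<in> S" using assms(3) by auto
    then show "x \<otimes>\<^bsub>subgrp G Q\<^esub> y = y \<otimes>\<^bsub>subgrp G Q\<^esub> x"
      using comm_monoid.m_comm[OF comm_group.axioms(1)[OF assms(4)], of x y] by simp
  qed
qed

theorem theorem3p2:
  fixes R :: "'a set \<Rightarrow> 'a monoid \<Rightarrow> bool"
    and G :: "'a monoid" and p :: nat and S D :: "'a set"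
  assumes "one_eternal R"
    and "group G" and "finite (carrier G)"
    and "prime p" and "p dvd order G"
    and "sylow_subgroup p G S"
    and "subgroup D G" and "{\<one>\<^bsub>G\<^esub>} \<subset> D" and "D \<subset> S"
    and "\<And>H. subgroup H G \<Longrightarrow> H \<subseteq> S \<Longrightarrow> card H = card D \<or> card H = p * card D \<Longrightarrow>
           comm_group (subgrp G H)"
    and "\<And>H. subgroup H G \<Longrightarrow> H \<subseteq> S \<Longrightarrow> card H = card D \<Longrightarrow> R H G"
    and "\<not> comm_group (subgrp G S) \<Longrightarrow> p_group 2 (subgrp G S) \<Longrightarrow> card D = 2 \<Longrightarrow>
           (\<And>H. subgroup H G \<Longrightarrow> H \<subseteq> S \<Longrightarrow> cyclic_group (subgrp G H) \<Longrightarrow> card H = 4 \<Longrightarrow> R H G)"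
  shows "supersolvable_fusion (subgrp G S) (fusion_system G S)"
proof -
  interpret group G by (rule assms(2))
  note fin = assms(3) and p = assms(4)
  have S: "subgroup S G" "card S = p ^ multiplicity p (order G)"
    using assms(6) by (auto simp: sylow_subgroup_def)
  have Sc: "S \<subseteq> carrier G" by (rule subgroup.subset[OF S(1)])
  have finS: "finite S" by (rule finite_subset[OF Sc fin])
  have sylS: "syl p (carrier G) S" using S Sc by (simp add: syl_def order_def)
  have DS: "D \<subseteq> S" using assms(9) by blast
  obtain e where e: "card D = p ^ e" by (rule subgroup_card_p_power[OF p S assms(7) DS])
  have D1: "1 < card D"
    using psubset_card_mono[OF finite_subset[OF DS finS] assms(8)] by simp
  have DSc: "card D < card S" by (rule psubset_card_mono[OF finS assms(9)])
  then have ek: "e < multiplicity p (order G)" using e S(2) prime_gt_1_nat[OF p] by simp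
  \<comment> \<open>This is used twice: with N = \<open>Nrm Q\<close> for self-centralising Q, and
    with N = \<open>Nrm S\<close> for Q = S. The relation of subgroups of Q to G passes to N by the
    first clause of 1-eternality.\<close>
  have hyp: "Q \<subseteq> supersolvable_hypercenter (subgrp G N)"
    if Q: "subgroup Q G" "Q \<subseteq> S" "card D < card Q" and N: "subgroup N G" "Q \<subseteq> N"
      and core: "p_core p (subgrp G N) = Q" for Q N
  proof -
    interpret N: group "subgrp G N" by (rule subgroup_imp_group[OF N(1)])
    have finN: "finite (carrier (subgrp G N))" using finite_subset[OF subgroup.subset[OF N(1)] fin] by simp
    obtain j where j: "card Q = p ^ j" by (rule subgroup_card_p_power[OF p S Q(1,2)])
    then have ej: "e < j" using Q(3) e prime_gt_1_nat[OF p] by simp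
    have "p dvd card Q" using j ej by (cases j) auto
    then have "p dvd order (subgrp G N)"
      using subgroup_card_dvd[OF Q(1) N] by (auto simp: order_def dest: dvd_trans)
    \<comment> \<open>D itself need not lie in Q, so it is replaced by a subgroup of Q of the same
      order.\<close>
    moreover obtain E where E: "subgroup E (subgrp G Q)" "card E = p ^ e"
      using sylow_thm[OF p subgroup_imp_group[OF Q(1)], of e "p ^ (j - e)"] j ej
        finite_subset[OF Q(2) finS] by (auto simp: order_def power_add[symmetric])
    have Es: "subgroup E G" "E \<subseteq> Q"
      using incl_subgroup[OF Q(1) E(1)] subgroup.subset[OF E(1)] by auto
    have RN: "R H (subgrp G N)" if "subgroup H (subgrp G N)" "H \<subseteq> Q" "R H G" for H
      by (rule one_eternal_subgroup[OF assms(1-3) incl_subgroup[OF N(1) that(1)] N(1) _ that(3)])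
        (use that(2) N(2) in blast)
    have "p_core p (subgrp G N) \<subseteq> supersolvable_hypercenter (subgrp G N)"
    proof (rule one_eternal_p_core[OF assms(1) N.group_axioms finN p])
      show "p dvd order (subgrp G N)" by fact
      show "subgroup E (subgrp G N)" using subgroup_incl[OF Es(1) N(1)] Es(2) N(2) by blast
      show "E \<subseteq> p_core p (subgrp G N)" unfolding core by (rule Es(2))
      show "1 < card E" "card E < card (p_core p (subgrp G N))"
        using D1 Q(3) E(2) e unfolding core by auto
    next
      fix H assume H: "subgroup H (subgrp G N)" "H \<subseteq> p_core p (subgrp G N)" "card H = card E"
      then have "H \<subseteq> S" using Q(2) unfolding core by blast
      then show "R H (subgrp G N)"
        using RN[OF H(1)] H(2,3) assms(11)[OF incl_subgroup[OF N(1) H(1)]] E(2) e unfolding core by simp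
    next
      fix H assume nc: "\<not> comm_group (subgrp (subgrp G N) (p_core p (subgrp G N)))" "card E = 2"
        and H: "subgroup H (subgrp G N)" "H \<subseteq> p_core p (subgrp G N)"
          "cyclic_group (subgrp (subgrp G N) H)" "card H = 4"
      have HS: "H \<subseteq> S" using H(2) Q(2) unfolding core by blast
      \<comment> \<open>If Q is non-abelian, so is S, and \<open>card D = 2\<close> forces p = 2;
        thus the assumption on cyclic subgroups of order 4 becomes available.\<close>
      have "\<not> comm_group (subgrp G Q)" using nc(1) unfolding core by simp
      then have ncS: "\<not> comm_group (subgrp G S)"
        using comm_group_subgrp_mono[OF assms(2) Q(1,2)] by blast
      have c2: "card D = 2" using nc(2) E(2) e by simp
      have "e > 0" using D1 e by (cases e) auto
      then have "p dvd p ^ e" by (simp add: dvd_power)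
      then have "p dvd 2" using c2 e by simp
      then have "p = 2" using p by (simp add: primes_dvd_imp_eq two_is_prime_nat)
      then have "p_group 2 (subgrp G S)"
        using S(2) subgroup_imp_group[OF S(1)] by (auto simp: p_group_def order_def)
      then have "R H G"
        using assms(12)[OF ncS _ c2 incl_subgroup[OF N(1) H(1)] HS] H(3,4) by simp
      then show "R H (subgrp G N)" using RN[OF H(1)] H(2) unfolding core by blast
    qed
    then show ?thesis unfolding core .
  qed
  have ctrl: "\<exists>h\<in>Nrm S. \<forall>x\<in>P. conjby g x = conjby h x"
    if P: "subgroup P G" "P \<subseteq> S" "g \<in> carrier G" "conjby g ` P \<subseteq> S" for P g
  proof (rule normalizer_controls_fusion[OF fin p sylS _ P])
    fix Q n
    assume Q: "subgroup Q G" "Q \<subset> S" and syl: "syl p (Nrm Q) (Nrm Q \<inter> S)" and n: "n \<in> Nrm Q"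
    have QS: "Q \<subseteq> S" using Q(2) by blast
    note Qc = subgroup.subset[OF Q(1)]
    show "\<exists>L m. subgroup L G \<and> Q \<subset> L \<and> L \<subseteq> S \<and> m \<in> Nrm L \<and> (\<forall>x\<in>Q. conjby n x = conjby m x)"
    proof (cases "Cen Q \<inter> S \<subseteq> Q")
      case False
      then show ?thesis by (rule extend_noncentric[OF fin p S(1) Q(1) QS syl _ n])
    next
      case True
      \<comment> \<open>The strict inequality is what 1-eternality asks for when the core of
        \<open>Nrm Q\<close> is Q.\<close>
      have "p ^ e < card Q"
        by (rule centric_card_gt[OF fin p S Q True ek]) (use assms(10) e in auto)
      then have "card D < card Q" using e by simp
      then show ?thesis
        by (intro extend_hypercentral[OF fin p S Q syl n]
            hyp[OF Q(1) QS _ Nrm_subgroup[OF Qc] Nrm_self[OF finite_subset[OF Qc fin] Q(1)]])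
    qed
  qed
  have NS: "subgroup (Nrm S) G" by (rule Nrm_subgroup[OF Sc])
  have SN: "S \<subseteq> Nrm S" by (rule Nrm_self[OF finS S(1)])
  interpret NS: group "subgrp G (Nrm S)" by (rule subgroup_imp_group[OF NS])
  have finNS: "finite (carrier (subgrp G (Nrm S)))"
    using finite_subset[OF subgroup.subset[OF NS] fin] by simp
  have "S \<lhd> subgrp G (Nrm S)" by (rule normal_subgrpI[OF NS S(1) SN]) simp
  then have 1: "S \<subseteq> p_core p (subgrp G (Nrm S))" by (rule NS.le_p_core[OF finNS p _ S(2)])
  have core: "p_core p (subgrp G (Nrm S)) = S"
  proof -
    note O = subgrp_normal_le_Nrm[OF fin NS NS.p_core_normal[OF finNS p]]
    obtain j where j: "card (p_core p (subgrp G (Nrm S))) = p ^ j" using NS.p_core_card[OF finNS p] by blast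
    \<comment> \<open>S already has the largest possible order of a p-subgroup of G, so the core,
      which contains S, cannot be larger.\<close>
    have "card (p_core p (subgrp G (Nrm S))) \<le> p ^ multiplicity p (card (carrier G))"
      by (rule p_subgroup_card_le[OF fin p subgroup_self O(1) subgroup.subset[OF O(1)] j])
    then have "card (p_core p (subgrp G (Nrm S))) \<le> card S" using S(2) by (simp add: order_def)
    then show ?thesis
      using card_seteq[OF finite_subset[OF subgroup.subset[OF O(1)] fin] 1] by simp
  qed
  show ?thesis
    by (rule supersolvable_fusionI[OF S(1) fin ctrl hyp[OF S(1) order_refl DSc NS SN core]])
qed

end
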